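(* Let $n \ge 2$. For real $t > 0$ consider the signed measures $\nu_{n,-t}^{\ast}$ on $S_n$. Then: (1) For every real $t > 0$ with $t(t+1) > n-2$, $\nu_{n,-t}^{\ast}(g) > 0$ for all $g \in S_n$, so $\nu_{n,-t}^{\ast}$ is a probability measure on $S_n$ with full support. (2) For every integer $k \ge 1$ with $k(k+1) \le n-2$, $\nu_{n,-k}^{\ast}(g) \ge 0$ for all $g \in S_n$, so $\nu_{n,-k}^{\ast}$ is a probability measure on $S_n$; it does not have full support: it vanishes on the conjugacy class $C_\mu$ with $\mu = \langle 2^{n/2}\rangle$ if $n$ is even, and with $\mu = \langle 1, 2^{(n-1)/2}\rangle$ if $n$ is odd. (3) For every $g \in S_n$, $\lim_{t\to\infty} \nu_{n,-t}^{\ast}(g) = \frac{1}{n!}$.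
   Context: For $m\ge1$, $M_m(X) = \frac{1}{m}\sum_{d\mid m}\mu(d)X^{m/d}$ ($\mu(d)$ the Möbius function); $\binom{w}{k} = \frac{w(w-1)\cdots(w-k+1)}{k!}$; for a partition $\mu$ of $n$, $c_i(\mu)$ is the number of parts equal to $i$ and $C_\mu\subset S_n$ is the conjugacy class of cycle type $\mu$. For $z \in \mathbb{C}\setminus\{0,1\}$, $\nu_{n,z}^{\ast}(C_\mu) = \frac{1}{z^{n-1}(z-1)}\prod_{i=1}^n\binom{M_i(z)}{c_i(\mu)}$ and $\nu_{n,z}^{\ast}(g) = \nu_{n,z}^{\ast}(C_\mu)/|C_\mu|$ for $g\in C_\mu$. Bracket notation $\langle 1^{a_1}, 2^{a_2},\dots\rangle$ denotes the partition with $a_i$ parts equal to $i$.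
   Formalization: In part (1) the formal statement additionally requires t > 1 when n = 3; without this the claim is false, since ν*_{3,-t}(C_⟨3⟩) = (t-1)/(3t) is not positive for t ≤ 1, although t(t+1) > 1 holds for t > (√5-1)/2. *)

theory Defs
  imports
    "HOL-Probability.Probability_Mass_Function"
    "HOL-Combinatorics.Orbits"
    "HOL-Computational_Algebra.Squarefree"
begin

definition moebius_mu :: "nat \<Rightarrow> int" where
  "moebius_mu d = (if squarefree d then (-1) ^ card (prime_factors d) else 0)"

definition necklace :: "nat \<Rightarrow> complex \<Rightarrow> complex" where
  "necklace m z = (\<Sum>d | d dvd m. of_int (moebius_mu d) * z ^ (m div d)) / of_nat m"

definition Sn :: "nat \<Rightarrow> (nat \<Rightarrow> nat) set" where
  "Sn n = {g. g permutes {1..n}}"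

text \<open>A partition of \<open>n\<close> is the multiset of its (positive) parts, so \<open>c\<^sub>i(\<mu>)\<close> is
  \<open>count \<mu> i\<close>. The cycles of \<open>g\<close>, fixed points included, are its orbits on \<open>{1..n}\<close>.\<close>

definition cycle_type :: "nat \<Rightarrow> (nat \<Rightarrow> nat) \<Rightarrow> nat multiset" where
  "cycle_type n g = image_mset card (mset_set (orbit g ` {1..n}))"

definition conj_class :: "nat \<Rightarrow> nat multiset \<Rightarrow> (nat \<Rightarrow> nat) set" where
  "conj_class n \<mu> = {g \<in> Sn n. cycle_type n g = \<mu>}"

definition nu_class :: "nat \<Rightarrow> complex \<Rightarrow> nat multiset \<Rightarrow> complex" where
  "nu_class n z \<mu> =
     1 / (z ^ (n - 1) * (z - 1)) * (\<Prod>i = 1..n. necklace i z gchoose count \<mu> i)"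

definition nu :: "nat \<Rightarrow> complex \<Rightarrow> (nat \<Rightarrow> nat) \<Rightarrow> complex" where
  "nu n z g = nu_class n z (cycle_type n g) / of_nat (card (conj_class n (cycle_type n g)))"

definition is_pmf_of_nu :: "nat \<Rightarrow> complex \<Rightarrow> (nat \<Rightarrow> nat) pmf \<Rightarrow> bool" where
  "is_pmf_of_nu n z p \<longleftrightarrow>
     set_pmf p \<subseteq> Sn n \<and> (\<forall>g \<in> Sn n. nu n z g = complex_of_real (pmf p g))"

end

theory Submission
  imports Defs "HOL-Computational_Algebra.Formal_Laurent_Series" "HOL-Real_Asymp.Real_Asymp"
begin

unbundle no vec_syntax

text \<open>
  Write \<open>z = -t\<close> and \<open>M\<^sub>i = M\<^sub>i(-t)\<close>. Since \<open>\<Sum>i c\<^sub>i = n\<close>, the sign of the prefactor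
  \<open>1 / (z\<^bsup>n-1\<^esup> (z - 1))\<close> is absorbed by giving each binomial the sign \<open>(-1)\<^bsup>i c\<^sub>i\<^esup>\<close>. For odd \<open>i\<close> one has
  \<open>M\<^sub>i \<le> 0\<close>, so \<open>(-1)\<^bsup>c\<^esup> binom(M\<^sub>i, c) \<ge> 0\<close> always; for even \<open>i\<close> positivity needs \<open>M\<^sub>i > c\<^sub>i - 1\<close>, the extreme
  case being \<open>M\<^sub>2 = t(t+1)/2\<close> against \<open>c\<^sub>2 \<le> n/2\<close>. For larger even \<open>i\<close> the leading term of \<open>M\<^sub>i\<close> dominates
  once \<open>t \<ge> 2\<close>, and \<open>t < 2\<close> forces \<open>n \<le> 7\<close>. At a negative integer the \<open>M\<^sub>i\<close> with \<open>i\<close> even are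
  nonnegative integers, so the binomials are nonnegative, and the one for \<open>i = 2\<close> vanishes as soon as \<open>M\<^sub>2 < c\<^sub>2\<close>.

  The total mass comes from \<open>\<Prod>\<^sub>i (1 + x\<^sup>i)\<^bsup>M\<^sub>i(z)\<^esup> = (1 - z x\<^sup>2) / (1 - z x)\<close>, proved by comparing logarithmic
  derivatives. Integrality of \<open>M\<^sub>m\<close> also drops out of this identity by induction, because \<open>M\<^sub>m\<close> is the
  contribution of the partition \<open>\<langle>m\<rangle>\<close> to the coefficient of \<open>x\<^sup>m\<close>. For the limit, the leading term of
  \<open>\<Prod>\<^sub>i binom(M\<^sub>i, c\<^sub>i)\<close> is \<open>z\<^sup>n / \<Prod>\<^sub>i i\<^bsup>c\<^sub>i\<^esup> c\<^sub>i!\<close>, and \<open>|C\<^sub>\<mu>| = n! / \<Prod>\<^sub>i i\<^bsup>c\<^sub>i\<^esup> c\<^sub>i!\<close>.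
\<close>

section \<open>Sizes of conjugacy classes\<close>

lemma orbit_eq_if_mem:
  assumes "permutation f" "y \<in> orbit f x"
  shows "orbit f y = orbit f x"
proof -
  have "x \<in> orbit f y"
    using assms orbit_swap permutation_self_in_orbit by metis
  then show ?thesis using assms(2) orbit_trans by (metis subsetI subset_antisym)
qed

lemma pairwise_disjnt_orbits:
  assumes "permutation f"
  shows "pairwise disjnt (orbit f ` A)"
proof (rule pairwiseI)
  fix B C assume BC: "B \<in> orbit f ` A" "C \<in> orbit f ` A" "B \<noteq> C"
  then obtain x y where xy: "B = orbit f x" "C = orbit f y" by blast
  show "disjnt B C"
    unfolding disjnt_iff using orbit_eq_if_mem[OF assms] BC(3) unfolding xy by metis
qed

section \<open>Cycles of a permutation after a new point is inserted into one of them\<close>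

context
  fixes a b :: 'a and q h :: "'a \<Rightarrow> 'a" and S :: "'a set"
  assumes h: "h = Transposition.transpose a b \<circ> q"
    and q: "q permutes S" and fin: "finite S" and aS: "a \<notin> S" and bS: "b \<in> S"
begin

private lemma permutation_insert_transpose: "permutation h"
  using h q fin by (meson permutation_compose permutation_permutes permutation_swap_id)

private lemma perm_q: "permutation q"
  using q fin permutation_permutes by blast

private lemma h_step:
  assumes "y \<in> S"
  shows "h y = (if q y = b then a else q y)"
proof -
  have "q y \<noteq> a" using assms permutes_in_image[OF q, of y] aS by auto
  then show ?thesis by (simp add: h Transposition.transpose_def)
qed

private lemma h_a: "h a = b"
  using q aS by (simp add: h permutes_not_in)

text \<open>The maps \<open>h\<close> and \<open>q\<close> differ only at \<open>a\<close> and at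
  the \<open>q\<close>-preimage of \<open>b\<close>, and neither point lies on a
  \<open>q\<close>-cycle avoiding \<open>b\<close>.\<close>

lemma orbit_insert_transpose_other:
  assumes "x \<in> S" "b \<notin> orbit q x"
  shows "orbit h x = orbit q x"
proof -
  have sub: "orbit q x \<subseteq> S" using q assms(1) by (rule permutes_orbit_subset)
  show ?thesis
  proof (rule orbit_cong0[of x "orbit q x"])
    show "x \<in> orbit q x" using perm_q by (rule permutation_self_in_orbit)
    show "h \<in> orbit q x \<rightarrow> orbit q x"
    proof
      fix y assume y: "y \<in> orbit q x"
      then have "q y \<in> orbit q x" by (rule orbit.step)
      then show "h y \<in> orbit q x" using h_step[of y] sub y assms(2) by auto
    qed
    show "h y = q y" if "y \<in> orbit q x" for y
      using h_step[of y] orbit.step[OF that] sub that assms(2) by auto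
  qed
qed

text \<open>The map \<open>h\<close> runs through the \<open>q\<close>-cycle of \<open>b\<close>,
  but makes a detour over \<open>a\<close> just before it returns to \<open>b\<close>.\<close>

lemma orbit_insert_transpose_base: "orbit h b = insert a (orbit q b)"
proof
  have sub: "orbit q b \<subseteq> S" using q bS by (rule permutes_orbit_subset)
  have b_q: "b \<in> orbit q b" and b_h: "b \<in> orbit h b"
    using perm_q permutation_insert_transpose by (auto intro: permutation_self_in_orbit)
  have closed: "h y \<in> insert a (orbit q b)" if "y \<in> insert a (orbit q b)" for y
  proof (cases "y = a")
    case True
    show ?thesis unfolding True h_a using b_q by simp
  next
    case False
    then have y: "y \<in> orbit q b" "y \<in> S" using that sub by auto
    show ?thesis unfolding h_step[OF y(2)] using orbit.step[OF y(1)] by simp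
  qed
  show "orbit h b \<subseteq> insert a (orbit q b)"
  proof
    fix y assume "y \<in> orbit h b"
    then show "y \<in> insert a (orbit q b)"
      by (induction rule: orbit.induct) (use b_q closed in blast)+
  qed
  have 1: "orbit q b \<subseteq> orbit h b"
  proof
    fix y assume "y \<in> orbit q b"
    then show "y \<in> orbit h b"
    proof (induction rule: orbit.induct)
      case base then show ?case using h_step[OF bS] b_h orbit.base[of h b] by (auto split: if_splits)
    next
      case (step y)
      then have "y \<in> S" using sub by auto
      then show ?case using h_step[of y] b_h orbit.step[OF step(2)] by (auto split: if_splits)
    qed
  qed
  \<comment> \<open>The predecessor of \<open>b\<close> on its \<open>q\<close>-cycle is the point
    that \<open>h\<close> sends to \<open>a\<close>.\<close>
  obtain y where y: "y \<in> orbit q b" "q y = b"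
    using b_q by (cases rule: orbit.cases) (use b_q in auto)
  then have "h y = a" using sub h_step[of y] by auto
  then have "a \<in> orbit h b" using y 1 orbit.step[of y h b] by auto
  with 1 show "insert a (orbit q b) \<subseteq> orbit h b" by auto
qed

lemma orbits_insert_transpose:
  "orbit h ` insert a S = insert (insert a (orbit q b)) (orbit q ` S - {orbit q b})"
proof -
  have ha: "orbit h a = insert a (orbit q b)"
  proof -
    have "a \<in> orbit h b" using orbit_insert_transpose_base by simp
    then show ?thesis
      using orbit_eq_if_mem[OF permutation_insert_transpose, of a b] orbit_insert_transpose_base by simp
  qed
  have hx: "orbit h x = (if orbit q x = orbit q b then insert a (orbit q b) else orbit q x)"
    if "x \<in> S" for x
  proof (cases "b \<in> orbit q x")
    case True
    then have eq: "orbit q b = orbit q x" using perm_q orbit_eq_if_mem by metis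
    then have "x \<in> orbit h b"
      using orbit_insert_transpose_base perm_q permutation_self_in_orbit by (metis insertCI)
    then have "orbit h x = orbit h b" using orbit_eq_if_mem permutation_insert_transpose by metis
    then show ?thesis using eq orbit_insert_transpose_base by simp
  next
    case False
    moreover have "b \<in> orbit q b" using perm_q by (rule permutation_self_in_orbit)
    ultimately show ?thesis using orbit_insert_transpose_other[OF that] by auto
  qed
  show ?thesis using ha hx bS by (auto simp: image_iff)
qed

end

lemma finite_Sn: "finite (Sn n)"
  unfolding Sn_def by (simp add: finite_permutations)

lemma cycle_type_insert_fixed:
  assumes "q permutes {1..n}"
  shows "cycle_type (Suc n) q = add_mset 1 (cycle_type n q)"
proof -
  have o: "orbit q (Suc n) = {Suc n}"
    using assms by (simp add: orbit_eq_singleton_iff permutes_not_in)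
  have "{Suc n} \<notin> orbit q ` {1..n}"
  proof
    assume "{Suc n} \<in> orbit q ` {1..n}"
    then obtain x where "x \<in> {1..n}" "orbit q x = {Suc n}" by auto
    with permutes_orbit_subset[OF assms, of x] show False by auto
  qed
  then show ?thesis using o
    by (simp add: cycle_type_def atLeastAtMostSuc_conv del: image_mset_mset_set)
qed

lemma card_orbit_in_cycle_type:
  assumes "b \<in> {1..n}"
  shows "card (orbit q b) \<in># cycle_type n q"
  using assms by (auto simp: cycle_type_def)

lemma cycle_type_insert_transpose:
  assumes q: "q permutes {1..n}" and b: "b \<in> {1..n}"
  shows "cycle_type (Suc n) (Transposition.transpose (Suc n) b \<circ> q) =
    add_mset (Suc (card (orbit q b))) (cycle_type n q - {#card (orbit q b)#})"
proof -
  have a: "Suc n \<notin> {1..n}" by simp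
  have sub: "orbit q x \<subseteq> {1..n}" if "x \<in> {1..n}" for x
    using permutes_orbit_subset[OF q that] .
  \<comment> \<open>Only the enlarged cycle contains \<open>Suc n\<close>, so it is a new element of
    the set of cycles and \<open>mset_set\<close> counts it separately.\<close>
  have "insert (Suc n) (orbit q b) \<notin> orbit q ` {1..n} - {orbit q b}"
    using sub by fastforce
  moreover have "orbit (Transposition.transpose (Suc n) b \<circ> q) ` {1..Suc n} =
      insert (insert (Suc n) (orbit q b)) (orbit q ` {1..n} - {orbit q b})"
    using orbits_insert_transpose[OF refl q _ a b] by (simp add: atLeastAtMostSuc_conv)
  moreover have "card (insert (Suc n) (orbit q b)) = Suc (card (orbit q b))"
    using sub[OF b] finite_subset[OF sub[OF b]] by (subst card_insert_disjoint) auto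
  moreover have "mset_set (orbit q ` {1..n} - {orbit q b}) = mset_set (orbit q ` {1..n}) - {#orbit q b#}"
    using b by (subst mset_set_Diff) auto
  ultimately show ?thesis
    using b by (simp add: cycle_type_def image_mset_Diff)
qed

lemma card_orbit_pos:
  fixes n :: nat
  assumes "q permutes {1..n}" "b \<in> {1..n}"
  shows "0 < card (orbit q b)"
  using finite_subset[OF permutes_orbit_subset[OF assms] finite_atLeastAtMost] orbit_nonempty[of q b]
  by (simp add: card_gt_0_iff)

text \<open>Distinct cycles are disjoint, and each cycle of length \<open>k\<close> contributes
  \<open>k\<close> points. This counts the positions at which a new point can enter a cycle of
  length \<open>k\<close>.\<close>

lemma card_points_with_orbit_size:
  assumes q: "q permutes {1..n}"
  shows "card {b \<in> {1..n}. card (orbit q b) = k} = k * count (cycle_type n q) k"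
proof -
  let ?O = "{B \<in> orbit q ` {1..n}. card B = k}"
  have perm: "permutation q" using q permutation_permutes by blast
  have cnt: "count (cycle_type n q) k = card ?O"
    unfolding cycle_type_def by (rule count_image_mset_eq_card_vimage) simp
  have U: "{b \<in> {1..n}. card (orbit q b) = k} = \<Union> ?O"
  proof safe
    fix b assume "b \<in> {1..n}"
    then show "b \<in> \<Union>{B \<in> orbit q ` {1..n}. card B = card (orbit q b)}"
      using permutation_self_in_orbit[OF perm, of b] by blast
  next
    fix b x assume "b \<in> orbit q x" "x \<in> {1..n}"
    then show "b \<in> {1..n}" "card (orbit q b) = card (orbit q x)"
      using permutes_orbit_subset[OF q, of x] orbit_eq_if_mem[OF perm, of b x] by auto
  qed
  have "card (\<Union> ?O) = sum card ?O"
  proof (rule card_Union_disjoint)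
    show "pairwise disjnt ?O"
      using pairwise_disjnt_orbits[OF perm] by (rule pairwise_subset) auto
    show "finite A" if A: "A \<in> ?O" for A
    proof -
      obtain x where "x \<in> {1..n}" "A = orbit q x" using A by blast
      then show ?thesis using permutes_orbit_subset[OF q, of x] finite_subset by blast
    qed
  qed
  also have "\<dots> = k * card ?O" by simp
  finally show ?thesis using U cnt by simp
qed

section \<open>Partitions, centralizer orders and class sizes\<close>

definition partitions :: "nat \<Rightarrow> nat multiset set" where
  "partitions n = {\<mu>. 0 \<notin># \<mu> \<and> \<Sum>\<^sub># \<mu> = n}"

lemma cycle_type_in_partitions:
  assumes "g \<in> Sn n"
  shows "cycle_type n g \<in> partitions n"
proof -
  have q: "g permutes {1..n}" using assms by (simp add: Sn_def)
  have perm: "permutation g" using q permutation_permutes by blast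
  have fin: "finite (orbit g x)" if "x \<in> {1..n}" for x
    using that permutes_orbit_subset[OF q] finite_subset by blast
  have "\<Sum>\<^sub># (cycle_type n g) = sum card (orbit g ` {1..n})"
    by (simp add: cycle_type_def sum_unfold_sum_mset)
  also have "\<dots> = card (\<Union> (orbit g ` {1..n}))"
  proof (rule card_Union_disjoint[symmetric])
    show "pairwise disjnt (orbit g ` {1..n})"
      using perm by (rule pairwise_disjnt_orbits)
  qed (use fin in auto)
  also have "\<Union> (orbit g ` {1..n}) = {1..n}"
    using permutes_orbit_subset[OF q] permutation_self_in_orbit[OF perm] by blast
  finally have "\<Sum>\<^sub># (cycle_type n g) = n" by simp
  moreover have "0 \<notin># cycle_type n g"
    using card_orbit_pos[OF q] by (fastforce simp: cycle_type_def)
  ultimately show ?thesis by (simp add: partitions_def)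
qed

lemma partitions_parts:
  assumes "\<mu> \<in> partitions n"
  shows "set_mset \<mu> \<subseteq> {1..n}"
proof
  fix x assume x: "x \<in># \<mu>"
  then obtain \<nu> where "\<mu> = add_mset x \<nu>" by (metis multi_member_split)
  then have "x \<le> \<Sum>\<^sub># \<mu>" by simp
  with x assms show "x \<in> {1..n}" by (cases "x = 0") (auto simp: partitions_def)
qed

lemma sum_mset_eq_sum_count:
  fixes \<mu> :: "nat multiset"
  assumes "finite A" "set_mset \<mu> \<subseteq> A"
  shows "\<Sum>\<^sub># \<mu> = (\<Sum>i\<in>A. i * count \<mu> i)"
  using assms(2)
proof (induction \<mu>)
  case (add x \<mu>)
  have "(\<Sum>i\<in>A. i * count (add_mset x \<mu>) i) = (\<Sum>i\<in>A. (if i = x then x else 0) + i * count \<mu> i)"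
    by (intro sum.cong) auto
  then show ?case using add assms(1) by (simp add: sum.distrib)
qed simp

lemma partitions_sum_count:
  assumes "\<mu> \<in> partitions n"
  shows "(\<Sum>i = 1..n. i * count \<mu> i) = n"
  using sum_mset_eq_sum_count[OF _ partitions_parts[OF assms]] assms by (simp add: partitions_def)

text \<open>The order of the centralizer in the symmetric group of a permutation of cycle type
  \<mu>.\<close>

definition centralizer_size :: "nat multiset \<Rightarrow> nat" where
  "centralizer_size \<mu> = (\<Prod>i\<in>set_mset \<mu>. i ^ count \<mu> i * fact (count \<mu> i))"

lemma centralizer_size_superset:
  assumes "finite A" "set_mset \<mu> \<subseteq> A"
  shows "centralizer_size \<mu> = (\<Prod>i\<in>A. i ^ count \<mu> i * fact (count \<mu> i))"
  unfolding centralizer_size_def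
  using assms by (intro prod.mono_neutral_left) (auto simp: not_in_iff)

lemma centralizer_size_add_mset:
  "centralizer_size (add_mset k \<mu>) = k * (count \<mu> k + 1) * centralizer_size \<mu>"
proof -
  let ?A = "insert k (set_mset \<mu>)"
  have "centralizer_size (add_mset k \<mu>) =
      (\<Prod>i\<in>?A. i ^ count (add_mset k \<mu>) i * fact (count (add_mset k \<mu>) i))"
    by (rule centralizer_size_superset) auto
  also have "\<dots> = (\<Prod>i\<in>?A. (if i = k then k * (count \<mu> k + 1) else 1) * (i ^ count \<mu> i * fact (count \<mu> i)))"
    by (intro prod.cong) (auto simp: algebra_simps)
  also have "\<dots> = k * (count \<mu> k + 1) * (\<Prod>i\<in>?A. i ^ count \<mu> i * fact (count \<mu> i))"
    by (simp add: prod.distrib prod.delta del: prod.insert)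
  also have "(\<Prod>i\<in>?A. i ^ count \<mu> i * fact (count \<mu> i)) = centralizer_size \<mu>"
    by (rule centralizer_size_superset[symmetric]) auto
  finally show ?thesis .
qed


lemma partitions_0: "partitions 0 = {{#}}"
proof -
  have "\<mu> = {#}" if "\<mu> \<in> partitions 0" for \<mu>
    using partitions_parts[OF that] by simp
  then show ?thesis by (auto simp: partitions_def)
qed

text \<open>A permutation of \<open>{1..Suc n}\<close> either fixes \<open>Suc n\<close>, or it
  sends \<open>Suc n\<close> to some \<open>b\<close> in \<open>{1..n}\<close>; then undoing one
  transposition leaves a unique permutation of \<open>{1..n}\<close>.\<close>

lemma Sn_Suc_sum:
  "sum f (Sn (Suc n)) = (\<Sum>q\<in>Sn n. f q) +
     (\<Sum>b = 1..n. \<Sum>q\<in>Sn n. f (Transposition.transpose (Suc n) b \<circ> q))"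
  using sum_over_permutations_insert[of "{1..n}" "Suc n" f]
  by (simp add: Sn_def atLeastAtMostSuc_conv)

lemma card_conj_class_eq_sum: "card (conj_class n \<mu>) = (\<Sum>q\<in>Sn n. of_bool (cycle_type n q = \<mu>))"
  using finite_Sn by (simp add: conj_class_def sum_of_bool_eq Int_def)

text \<open>
  Induction on \<open>n\<close>: composing a permutation of \<open>{1..n}\<close> with the transposition of \<open>n + 1\<close> and \<open>b\<close>
  enlarges the cycle of \<open>b\<close> by one, and there are \<open>k c\<^sub>k\<close> choices of \<open>b\<close> in a cycle of length \<open>k\<close>.
\<close>

theorem card_conj_class_mult_centralizer_size:
  assumes "\<mu> \<in> partitions n"
  shows "card (conj_class n \<mu>) * centralizer_size \<mu> = fact n"
  using assms
proof (induction n arbitrary: \<mu>)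
  case 0
  then have "\<mu> = {#}" by (simp add: partitions_0)
  then show ?case by (simp add: conj_class_def Sn_def cycle_type_def centralizer_size_def)
next
  case (Suc n)
  \<comment> \<open>\<open>A\<close> counts the permutations of type \<mu> that fix
    \<open>Suc n\<close>, and \<open>B k\<close> those in which \<open>Suc n\<close> has entered a
    cycle of length \<open>k\<close>. Times the centralizer order, each becomes
    \<open>fact n\<close> times the number of points in parts of \<mu> of size 1 or
    \<open>Suc k\<close>, and all these points together number \<open>Suc n\<close>.\<close>
  define A where "A = (\<Sum>q\<in>Sn n. of_bool (add_mset 1 (cycle_type n q) = \<mu>) :: nat)"
  define B where "B k = (\<Sum>q\<in>Sn n. k * count (cycle_type n q) k *
    of_bool (add_mset (Suc k) (cycle_type n q - {#k#}) = \<mu>))" for k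
  have A: "A * centralizer_size \<mu> = count \<mu> 1 * fact n"
  proof (cases "1 \<in># \<mu>")
    case False
    then have "add_mset 1 (cycle_type n q) \<noteq> \<mu>" for q by auto
    then have "A = 0" by (simp add: A_def)
    with False show ?thesis by (simp add: not_in_iff)
  next
    case True
    then obtain \<nu> where \<nu>: "\<mu> = add_mset 1 \<nu>" by (metis multi_member_split)
    then have "\<nu> \<in> partitions n" using Suc.prems by (auto simp: partitions_def)
    then have "card (conj_class n \<nu>) * centralizer_size \<nu> = fact n" by (rule Suc.IH)
    moreover have "A = card (conj_class n \<nu>)" by (simp add: A_def \<nu> card_conj_class_eq_sum)
    moreover have "centralizer_size \<mu> = count \<mu> 1 * centralizer_size \<nu>"
      by (simp add: \<nu> centralizer_size_add_mset)
    ultimately show ?thesis by (metis mult.left_commute)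
  qed
  have B: "B k * centralizer_size \<mu> = Suc k * count \<mu> (Suc k) * fact n" if k: "k \<in> {1..n}" for k
  proof (cases "Suc k \<in># \<mu>")
    case False
    then have "add_mset (Suc k) (cycle_type n q - {#k#}) \<noteq> \<mu>" for q by auto
    then have "B k = 0" by (simp add: B_def)
    with False show ?thesis by (simp add: not_in_iff)
  next
    case True
    then obtain \<nu> where \<nu>: "\<mu> = add_mset (Suc k) \<nu>" by (metis multi_member_split)
    \<comment> \<open>Shortening one part \<open>Suc k\<close> of \<mu> to \<open>k\<close> recovers
      the only cycle type on \<open>n\<close> points that contributes to \<open>B k\<close>.\<close>
    have \<lambda>: "add_mset k \<nu> \<in> partitions n" using Suc.prems k by (auto simp: partitions_def \<nu>)
    have "k * count c k * of_bool (add_mset (Suc k) (c - {#k#}) = \<mu>) =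
        k * (count \<nu> k + 1) * of_bool (c = add_mset k \<nu>)" for c
    proof (cases "k \<in># c")
      case True
      then obtain d where "c = add_mset k d" by (metis multi_member_split)
      then show ?thesis by (auto simp: \<nu>)
    next
      case False
      then have "c \<noteq> add_mset k \<nu>" by auto
      with False show ?thesis by (simp add: not_in_iff)
    qed
    then have "B k = k * (count \<nu> k + 1) * card (conj_class n (add_mset k \<nu>))"
      by (simp add: B_def card_conj_class_eq_sum sum_distrib_left)
    moreover have "centralizer_size \<mu> = Suc k * count \<mu> (Suc k) * centralizer_size \<nu>"
      by (simp add: \<nu> centralizer_size_add_mset)
    ultimately have "B k * centralizer_size \<mu> = Suc k * count \<mu> (Suc k) *
        (card (conj_class n (add_mset k \<nu>)) * (k * (count \<nu> k + 1) * centralizer_size \<nu>))"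
      by (simp only: mult_ac)
    also have "k * (count \<nu> k + 1) * centralizer_size \<nu> = centralizer_size (add_mset k \<nu>)"
      by (simp add: centralizer_size_add_mset)
    also have "card (conj_class n (add_mset k \<nu>)) * centralizer_size (add_mset k \<nu>) = fact n"
      using \<lambda> by (rule Suc.IH)
    finally show ?thesis .
  qed
  have split_q: "(\<Sum>b = 1..n. of_bool (cycle_type (Suc n) (Transposition.transpose (Suc n) b \<circ> q) = \<mu>))
      = (\<Sum>k = 1..n. k * count (cycle_type n q) k *
          of_bool (add_mset (Suc k) (cycle_type n q - {#k#}) = \<mu>) :: nat)" (is "?l = ?r")
    if q: "q \<in> Sn n" for q
  proof -
    have q': "q permutes {1..n}" using q by (simp add: Sn_def)
    let ?f = "\<lambda>k. of_bool (add_mset (Suc k) (cycle_type n q - {#k#}) = \<mu>) :: nat"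
    have "card (orbit q b) \<in> {1..n}" if "b \<in> {1..n}" for b
      using partitions_parts[OF cycle_type_in_partitions[OF q]] card_orbit_in_cycle_type[OF that, of q] by blast
    then have im: "(\<lambda>b. card (orbit q b)) ` {1..n} \<subseteq> {1..n}" by blast
    have "?l = (\<Sum>b = 1..n. ?f (card (orbit q b)))"
      using cycle_type_insert_transpose[OF q'] by (intro sum.cong) auto
    also have "\<dots> = (\<Sum>k = 1..n. \<Sum>b \<in> {b \<in> {1..n}. card (orbit q b) = k}. ?f (card (orbit q b)))"
      using im by (intro sum.group[symmetric]) auto
    also have "\<dots> = (\<Sum>k = 1..n. \<Sum>b \<in> {b \<in> {1..n}. card (orbit q b) = k}. ?f k)"
      by (intro sum.cong) auto
    also have "\<dots> = ?r"
      using card_points_with_orbit_size[OF q'] by (simp only: sum_constant of_nat_id)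
    finally show ?thesis .
  qed
  have "card (conj_class (Suc n) \<mu>) = A + (\<Sum>b = 1..n. \<Sum>q\<in>Sn n.
      of_bool (cycle_type (Suc n) (Transposition.transpose (Suc n) b \<circ> q) = \<mu>))"
    unfolding card_conj_class_eq_sum Sn_Suc_sum A_def
    by (intro arg_cong2[where f = "(+)"] sum.cong refl)
       (simp add: cycle_type_insert_fixed Sn_def)
  also have "(\<Sum>b = 1..n. \<Sum>q\<in>Sn n.
      of_bool (cycle_type (Suc n) (Transposition.transpose (Suc n) b \<circ> q) = \<mu>)) =
      (\<Sum>q\<in>Sn n. \<Sum>k = 1..n. k * count (cycle_type n q) k *
          of_bool (add_mset (Suc k) (cycle_type n q - {#k#}) = \<mu>) :: nat)"
    by (subst sum.swap) (intro sum.cong refl split_q)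
  also have "\<dots> = (\<Sum>k = 1..n. B k)"
    unfolding B_def by (rule sum.swap)
  finally have "card (conj_class (Suc n) \<mu>) * centralizer_size \<mu> =
      A * centralizer_size \<mu> + (\<Sum>k = 1..n. B k * centralizer_size \<mu>)"
    by (simp add: distrib_right sum_distrib_right)
  also have "\<dots> = count \<mu> 1 * fact n + (\<Sum>k = 1..n. Suc k * count \<mu> (Suc k) * fact n)"
    using A B by simp
  also have "\<dots> = (\<Sum>k = 1..Suc n. k * count \<mu> k) * fact n"
    by (subst sum.atLeast_Suc_atMost)
       (simp_all add: distrib_right sum_distrib_right sum.shift_bounds_cl_Suc_ivl del: sum.cl_ivl_Suc)
  also have "\<dots> = fact (Suc n)"
    unfolding partitions_sum_count[OF Suc.prems] by simp
  finally show ?case .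
qed

text \<open>An empty class would turn the product \<open>fact n\<close> into zero. Thus no
  permutation of the given type has to be constructed, and finiteness of \<open>partitions n\<close>
  follows from that of \<open>Sn n\<close>.\<close>

lemma conj_class_nonempty:
  assumes "\<mu> \<in> partitions n"
  shows "conj_class n \<mu> \<noteq> {}"
  using card_conj_class_mult_centralizer_size[OF assms] by auto

lemma finite_partitions: "finite (partitions n)"
proof (rule finite_surj[OF finite_Sn[of n]])
  show "partitions n \<subseteq> cycle_type n ` Sn n"
    using conj_class_nonempty by (fastforce simp: conj_class_def)
qed

text \<open>Grouping by cycle type cancels the division by the class size. This reduces the total
  mass on \<open>Sn n\<close> to a sum over partitions.\<close>

lemma sum_Sn_average_over_conj_class:
  fixes f :: "nat multiset \<Rightarrow> 'a :: field_char_0"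
  shows "(\<Sum>g\<in>Sn n. f (cycle_type n g) / of_nat (card (conj_class n (cycle_type n g)))) =
    (\<Sum>\<mu>\<in>partitions n. f \<mu>)"
proof -
  have "(\<Sum>g\<in>Sn n. f (cycle_type n g) / of_nat (card (conj_class n (cycle_type n g)))) =
      (\<Sum>\<mu>\<in>partitions n. \<Sum>g\<in>{g \<in> Sn n. cycle_type n g = \<mu>}.
        f (cycle_type n g) / of_nat (card (conj_class n (cycle_type n g))))"
    using finite_Sn finite_partitions cycle_type_in_partitions
    by (intro sum.group[symmetric]) auto
  also have "\<dots> = (\<Sum>\<mu>\<in>partitions n. f \<mu>)"
  proof (rule sum.cong[OF refl])
    fix \<mu> assume \<mu>: "\<mu> \<in> partitions n"
    have "finite (conj_class n \<mu>)" using finite_Sn by (simp add: conj_class_def)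
    with conj_class_nonempty[OF \<mu>] have "card (conj_class n \<mu>) \<noteq> 0" by simp
    moreover have "(\<Sum>g\<in>{g \<in> Sn n. cycle_type n g = \<mu>}.
        f (cycle_type n g) / of_nat (card (conj_class n (cycle_type n g)))) =
        (\<Sum>g\<in>conj_class n \<mu>. f \<mu> / of_nat (card (conj_class n \<mu>)))"
      by (intro sum.cong) (auto simp: conj_class_def)
    ultimately show "(\<Sum>g\<in>{g \<in> Sn n. cycle_type n g = \<mu>}.
        f (cycle_type n g) / of_nat (card (conj_class n (cycle_type n g)))) = f \<mu>"
      by simp
  qed
  finally show ?thesis .
qed

section \<open>Moebius inversion\<close>

lemma moebius_mu_mult_prime:
  assumes p: "prime p" and "\<not> p dvd d"
  shows "moebius_mu (p * d) = - moebius_mu d"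
proof -
  have cop: "coprime p d" using assms by (simp add: prime_imp_coprime)
  have sq: "squarefree (p * d) \<longleftrightarrow> squarefree d"
    using cop p by (auto simp: squarefree_mult_coprime squarefree_prime dest: squarefree_multD)
  have "d \<noteq> 0" using assms(2) by (metis dvd_0_right)
  moreover have "p \<noteq> 0" using p by auto
  ultimately have "prime_factors (p * d) = insert p (prime_factors d)"
    using p by (simp add: prime_factors_product prime_factorization_prime)
  moreover have "p \<notin> prime_factors d" using assms(2) by auto
  ultimately have "card (prime_factors (p * d)) = Suc (card (prime_factors d))" by simp
  then show ?thesis using sq by (simp add: moebius_mu_def)
qed

lemma moebius_mu_1 [simp]: "moebius_mu (Suc 0) = 1"
  using squarefree_1[where ?'a = nat] by (simp add: moebius_mu_def)

lemma moebius_mu_eq_0_if_square_dvd: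
  assumes "prime p" "p dvd d"
  shows "moebius_mu (p * d) = 0"
proof -
  have "p\<^sup>2 dvd p * d" using assms by (auto simp: power2_eq_square)
  then have "\<not> squarefree (p * d)" using assms(1) by (metis not_prime_unit squarefreeD)
  then show ?thesis by (simp add: moebius_mu_def)
qed

text \<open>For a prime \<open>p\<close> dividing \<open>n\<close>, each divisor \<open>d\<close>
  prime to \<open>p\<close> cancels against \<open>p * d\<close>. The remaining divisors are
  multiples of \<open>p^2\<close> and contribute zero.\<close>

lemma sum_moebius_mu_divisors:
  assumes "n > 0"
  shows "(\<Sum>d | d dvd n. moebius_mu d) = (if n = 1 then 1 else 0)"
proof (cases "n = 1")
  case False
  then obtain p where p: "prime p" "p dvd n" using prime_factor_nat by blast
  have fin: "finite {d. d dvd n}" using assms by simp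
  let ?A = "{d. d dvd n \<and> \<not> p dvd d}" and ?B = "{d. d dvd n \<and> p dvd d}"
  have "(\<Sum>d | d dvd n. moebius_mu d) = sum moebius_mu ?A + sum moebius_mu ?B"
    using fin by (subst sum.union_disjoint[symmetric]) (auto intro!: arg_cong2[where f = sum])
  also have "sum moebius_mu ?B = sum moebius_mu ((*) p ` ?A)"
  proof (rule sum.mono_neutral_right)
    show "finite ?B" using fin by simp
    show "(*) p ` ?A \<subseteq> ?B"
      using p by (auto intro: divides_mult simp: prime_imp_coprime)
    show "\<forall>d\<in>?B - (*) p ` ?A. moebius_mu d = 0"
    proof
      fix d assume d: "d \<in> ?B - (*) p ` ?A"
      then obtain e where e: "d = p * e" by auto
      with d have "p dvd e" using dvd_mult_right by auto
      with e p show "moebius_mu d = 0" by (simp add: moebius_mu_eq_0_if_square_dvd)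
    qed
  qed
  also have "\<dots> = (\<Sum>d\<in>?A. moebius_mu (p * d))"
    using p by (subst sum.reindex) (auto simp: inj_on_def)
  also have "\<dots> = - sum moebius_mu ?A"
    using p by (simp add: moebius_mu_mult_prime sum_negf)
  finally show ?thesis using False by simp
qed simp

text \<open>For a positive integer \<open>z\<close> this counts the aperiodic words of length \<open>m\<close> over \<open>z\<close> letters.\<close>

definition primitive_words :: "nat \<Rightarrow> 'a \<Rightarrow> 'a :: comm_ring_1" where
  "primitive_words m z = (\<Sum>d | d dvd m. of_int (moebius_mu d) * z ^ (m div d))"

text \<open>Group the pairs \<open>(m, d)\<close> by the exponent \<open>j = m div d\<close>: then
  \<open>d\<close> runs over the divisors of \<open>n div j\<close>, and their Moebius sum vanishes
  unless \<open>j = n\<close>.\<close>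

lemma sum_primitive_words_divisors:
  assumes "n > 0"
  shows "(\<Sum>m | m dvd n. primitive_words m z) = z ^ n"
proof -
  have fin: "finite {d. d dvd m}" if "m dvd n" for m
    using that assms by (metis dvd_0_left_iff finite_divisors_nat gr0I)
  have div_pos: "n div j > 0" if "j dvd n" for j
    using that assms by (metis dvd_div_eq_0_iff not_gr0)
  have div_eq_1: "n div j = 1 \<longleftrightarrow> j = n" if "j dvd n" for j
    using that assms by (metis div_self dvd_mult_div_cancel mult.right_neutral not_gr0)
  have "(\<Sum>m | m dvd n. primitive_words m z) =
      (\<Sum>(m, d) \<in> (SIGMA m:{m. m dvd n}. {d. d dvd m}). of_int (moebius_mu d) * z ^ (m div d))"
    unfolding primitive_words_def using fin by (subst sum.Sigma) auto
  also have "\<dots> = (\<Sum>(j, d) \<in> (SIGMA j:{j. j dvd n}. {d. d dvd n div j}). of_int (moebius_mu d) * z ^ j)"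
  proof (rule sum.reindex_bij_witness[where i = "\<lambda>(j, d). (j * d, d)" and j = "\<lambda>(m, d). (m div d, d)"])
    fix x assume "x \<in> (SIGMA m:{m. m dvd n}. {d. d dvd m})"
    then obtain d e k where "x = (d * e, d)" "n = d * e * k" by (auto elim!: dvdE)
    with assms show "(case case x of (m, d) \<Rightarrow> (m div d, d) of (j, d) \<Rightarrow> (j * d, d)) = x"
      "(case x of (m, d) \<Rightarrow> (m div d, d)) \<in> (SIGMA j:{j. j dvd n}. {d. d dvd n div j})"
      by auto
  next
    fix x assume "x \<in> (SIGMA j:{j. j dvd n}. {d. d dvd n div j})"
    then obtain j d where "x = (j, d)" "j dvd n" "d dvd n div j" by auto
    moreover from this obtain k where "n div j = d * k" by (meson dvdE)
    ultimately have "x = (j, d)" "n = j * d * k" by (simp, metis dvd_mult_div_cancel mult.assoc)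
    with assms show "(case case x of (j, d) \<Rightarrow> (j * d, d) of (m, d) \<Rightarrow> (m div d, d)) = x"
      "(case x of (j, d) \<Rightarrow> (j * d, d)) \<in> (SIGMA m:{m. m dvd n}. {d. d dvd m})"
      by auto
  qed auto
  also have "\<dots> = (\<Sum>j | j dvd n. \<Sum>d | d dvd n div j. of_int (moebius_mu d) * z ^ j)"
    using assms div_pos by (subst sum.Sigma) auto
  also have "\<dots> = (\<Sum>j | j dvd n. of_int (\<Sum>d | d dvd n div j. moebius_mu d) * z ^ j)"
    by (simp add: sum_distrib_right)
  also have "\<dots> = (\<Sum>j | j dvd n. if j = n then z ^ n else 0)"
  proof (rule sum.cong[OF refl])
    fix j assume "j \<in> {j. j dvd n}"
    then have "n div j > 0" "n div j = 1 \<longleftrightarrow> j = n" using div_pos div_eq_1 by auto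
    then show "of_int (\<Sum>d | d dvd n div j. moebius_mu d) * z ^ j = (if j = n then z ^ n else 0)"
      using sum_moebius_mu_divisors[of "n div j"] by auto
  qed
  also have "\<dots> = z ^ n" using assms by simp
  finally show ?thesis .
qed

text \<open>The formula of \<open>necklace\<close> over any field of characteristic 0, so that signs
  and limits can be studied over the reals.\<close>

definition necklace_poly :: "nat \<Rightarrow> 'a \<Rightarrow> 'a :: field_char_0" where
  "necklace_poly m z = primitive_words m z / of_nat m"

lemma primitive_words_eq_mult_necklace_poly:
  "m > 0 \<Longrightarrow> primitive_words m z = of_nat m * necklace_poly m z"
  by (simp add: necklace_poly_def)

text \<open>The sign subtracts twice the terms with \<open>n div m\<close> even, and these
  \<open>m\<close> are the divisors of \<open>n div 2\<close>. The right side is the coefficient of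
  \<open>x^n\<close> in \<open>x\<close> times the logarithmic derivative of
  \<open>(1 - z x^2) / (1 - z x)\<close>.\<close>

lemma sum_signed_primitive_words_divisors:
  assumes "n > 0"
  shows "(\<Sum>m | m dvd n. (- 1) ^ (n div m - 1) * primitive_words m z) =
    z ^ n - (if even n then 2 * z ^ (n div 2) else 0)"
proof -
  have fin: "finite {m. m dvd n}" using assms by simp
  have "(\<Sum>m | m dvd n. (- 1) ^ (n div m - 1) * primitive_words m z) =
      (\<Sum>m | m dvd n. primitive_words m z - (if even (n div m) then 2 * primitive_words m z else 0))"
  proof (rule sum.cong[OF refl])
    fix m assume "m \<in> {m. m dvd n}"
    then have "n div m > 0" using assms by (auto elim!: dvdE)
    then show "(- 1) ^ (n div m - 1) * primitive_words m z =
        primitive_words m z - (if even (n div m) then 2 * primitive_words m z else 0)"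
      by (cases "n div m") auto
  qed
  also have "\<dots> = z ^ n - 2 * (\<Sum>m | m dvd n \<and> even (n div m). primitive_words m z)"
    using fin assms by (simp add: sum_subtractf sum_primitive_words_divisors sum.If_cases sum_distrib_left Int_def)
  also have "2 * (\<Sum>m | m dvd n \<and> even (n div m). primitive_words m z) =
      (if even n then 2 * z ^ (n div 2) else 0)"
  proof (cases "even n")
    case False
    then have "{m. m dvd n \<and> even (n div m)} = {}"
      by (metis (no_types, lifting) Collect_empty_eq dvd_mult_div_cancel even_mult_iff)
    with False show ?thesis by (metis (no_types, lifting) mult_zero_right sum.empty)
  next
    case True
    then obtain k where k: "n = 2 * k" by (rule evenE)
    with assms have "k > 0" by simp
    have "m dvd n \<and> even (n div m) \<longleftrightarrow> m dvd k" for m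
    proof
      assume m: "m dvd n \<and> even (n div m)"
      then obtain e where "n div m = 2 * e" by auto
      with m have "2 * k = m * (2 * e)" by (metis dvd_mult_div_cancel k)
      then show "m dvd k" by simp
    next
      assume "m dvd k"
      then obtain e where e: "k = m * e" ..
      with \<open>k > 0\<close> have "n div m = 2 * e" by (simp add: k)
      with e show "m dvd n \<and> even (n div m)" by (simp add: k)
    qed
    then show ?thesis using sum_primitive_words_divisors[OF \<open>k > 0\<close>, of z] by (simp add: k)
  qed
  finally show ?thesis .
qed

section \<open>The generating function of squarefree factorization types\<close>

text \<open>The bound on the parts and the size vary separately, so that a product of
  \<open>N\<close> series can be expanded by induction on \<open>N\<close>.\<close>

definition bounded_partitions :: "nat \<Rightarrow> nat \<Rightarrow> nat multiset set" where
  "bounded_partitions N m = {\<mu>. set_mset \<mu> \<subseteq> {1..N} \<and> \<Sum>\<^sub># \<mu> = m}"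

text \<open>A partition is split into the multiplicity \<open>c\<close> of its part
  \<open>Suc N\<close> and its smaller parts.\<close>

lemma bounded_partitions_Suc:
  "bij_betw (\<lambda>(c, \<mu>). \<mu> + replicate_mset c (Suc N))
     (SIGMA c:{c. Suc N * c \<le> m}. bounded_partitions N (m - Suc N * c))
     (bounded_partitions (Suc N) m)"
proof (rule bij_betw_byWitness[where f' = "\<lambda>\<mu>. (count \<mu> (Suc N), filter_mset (\<lambda>i. i \<noteq> Suc N) \<mu>)"])
  have split: "filter_mset (\<lambda>i. i \<noteq> Suc N) \<mu> + replicate_mset (count \<mu> (Suc N)) (Suc N) = \<mu>" for \<mu>
    by (rule multiset_eqI) auto
  show "\<forall>x \<in> (SIGMA c:{c. Suc N * c \<le> m}. bounded_partitions N (m - Suc N * c)).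
      (\<lambda>\<mu>. (count \<mu> (Suc N), filter_mset (\<lambda>i. i \<noteq> Suc N) \<mu>))
        (case x of (c, \<mu>) \<Rightarrow> \<mu> + replicate_mset c (Suc N)) = x"
  proof
    fix x assume "x \<in> (SIGMA c:{c. Suc N * c \<le> m}. bounded_partitions N (m - Suc N * c))"
    then obtain c \<mu> where x: "x = (c, \<mu>)" "set_mset \<mu> \<subseteq> {1..N}" by (auto simp: bounded_partitions_def)
    then have "count \<mu> (Suc N) = 0" by (metis atLeastAtMost_iff not_in_iff not_less_eq_eq order_refl subsetD)
    moreover from this have "filter_mset (\<lambda>i. i \<noteq> Suc N) (\<mu> + replicate_mset c (Suc N)) = \<mu>"
      by (intro multiset_eqI) auto
    ultimately show "(\<lambda>\<mu>. (count \<mu> (Suc N), filter_mset (\<lambda>i. i \<noteq> Suc N) \<mu>))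
        (case x of (c, \<mu>) \<Rightarrow> \<mu> + replicate_mset c (Suc N)) = x" by (simp add: x(1))
  qed
  show "\<forall>\<mu>\<in>bounded_partitions (Suc N) m.
      (case (count \<mu> (Suc N), filter_mset (\<lambda>i. i \<noteq> Suc N) \<mu>) of
        (c, \<mu>) \<Rightarrow> \<mu> + replicate_mset c (Suc N)) = \<mu>"
    using split by simp
  show "(\<lambda>(c, \<mu>). \<mu> + replicate_mset c (Suc N)) `
      (SIGMA c:{c. Suc N * c \<le> m}. bounded_partitions N (m - Suc N * c)) \<subseteq> bounded_partitions (Suc N) m"
    by (force simp: bounded_partitions_def sum_mset_replicate_mset mult.commute)
  show "(\<lambda>\<mu>. (count \<mu> (Suc N), filter_mset (\<lambda>i. i \<noteq> Suc N) \<mu>)) ` bounded_partitions (Suc N) m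
      \<subseteq> (SIGMA c:{c. Suc N * c \<le> m}. bounded_partitions N (m - Suc N * c))"
  proof
    fix x assume "x \<in> (\<lambda>\<mu>. (count \<mu> (Suc N), filter_mset (\<lambda>i. i \<noteq> Suc N) \<mu>)) ` bounded_partitions (Suc N) m"
    then obtain \<mu> where \<mu>: "x = (count \<mu> (Suc N), filter_mset (\<lambda>i. i \<noteq> Suc N) \<mu>)"
      "set_mset \<mu> \<subseteq> {1..Suc N}" "\<Sum>\<^sub># \<mu> = m" by (auto simp: bounded_partitions_def)
    have "\<Sum>\<^sub># \<mu> = \<Sum>\<^sub># (filter_mset (\<lambda>i. i \<noteq> Suc N) \<mu>) + Suc N * count \<mu> (Suc N)"
      using arg_cong[OF split[of \<mu>], of sum_mset]
      by (simp add: sum_mset_replicate_mset mult.commute)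
    with \<mu> show "x \<in> (SIGMA c:{c. Suc N * c \<le> m}. bounded_partitions N (m - Suc N * c))"
      by (auto simp: bounded_partitions_def le_Suc_eq)
  qed
qed

lemma finite_bounded_partitions: "finite (bounded_partitions N m)"
proof (induction N arbitrary: m)
  case 0
  have "bounded_partitions 0 m \<subseteq> {{#}}" by (auto simp: bounded_partitions_def)
  then show ?case by (rule finite_subset) simp
next
  case (Suc N)
  have "finite {c. Suc N * c \<le> m}"
    by (rule finite_subset[of _ "{..m}"]) (auto simp: trans_le_add1)
  then show ?case
    using bij_betw_finite[OF bounded_partitions_Suc[of N m]] Suc by (simp add: finite_SigmaI)
qed

text \<open>Taking the term of degree \<open>i * c\<close> from the factor with index
  \<open>i\<close> amounts to giving the part \<open>i\<close> multiplicity
  \<open>c\<close>.\<close>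

lemma fps_nth_prod_compose_X_power:
  fixes f :: "nat \<Rightarrow> 'a :: comm_ring_1 fps"
  shows "(\<Prod>i = 1..N. f i oo fps_X ^ i) $ m =
    (\<Sum>\<mu>\<in>bounded_partitions N m. \<Prod>i = 1..N. f i $ count \<mu> i)"
proof (induction N arbitrary: m)
  case 0
  have "bounded_partitions 0 m = (if m = 0 then {{#}} else {})" by (auto simp: bounded_partitions_def)
  then show ?case by simp
next
  case (Suc N)
  let ?F = "\<Prod>i = 1..N. f i oo fps_X ^ i" and ?C = "{c. Suc N * c \<le> m}"
  have C: "finite ?C" by (rule finite_subset[of _ "{..m}"]) (auto simp: trans_le_add1)
  have "(\<Prod>i = 1..Suc N. f i oo fps_X ^ i) $ m = ((f (Suc N) oo fps_X ^ Suc N) * ?F) $ m"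
    by (simp add: mult.commute)
  also have "\<dots> = (\<Sum>j = 0..m. (f (Suc N) oo fps_X ^ Suc N) $ j * ?F $ (m - j))"
    by (rule fps_mult_nth)
  \<comment> \<open>The new factor is a series in the power \<open>Suc N\<close> of the variable, so
    only exponents divisible by \<open>Suc N\<close> survive.\<close>
  also have "\<dots> = (\<Sum>j \<in> (*) (Suc N) ` ?C. (f (Suc N) oo fps_X ^ Suc N) $ j * ?F $ (m - j))"
  proof (rule sum.mono_neutral_right)
    show "\<forall>j\<in>{0..m} - (*) (Suc N) ` ?C. (f (Suc N) oo fps_X ^ Suc N) $ j * ?F $ (m - j) = 0"
    proof
      fix j assume "j \<in> {0..m} - (*) (Suc N) ` ?C"
      then have "\<not> Suc N dvd j" by (auto elim!: dvdE)
      then show "(f (Suc N) oo fps_X ^ Suc N) $ j * ?F $ (m - j) = 0"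
        by (simp add: fps_nth_compose_X_power del: power_Suc)
    qed
  qed auto
  also have "\<dots> = (\<Sum>c\<in>?C. f (Suc N) $ c * ?F $ (m - Suc N * c))"
    by (subst sum.reindex) (auto simp: inj_on_def fps_nth_compose_X_power simp del: power_Suc mult_Suc)
  also have "\<dots> = (\<Sum>(c, \<mu>)\<in>(SIGMA c:?C. bounded_partitions N (m - Suc N * c)).
      f (Suc N) $ c * (\<Prod>i = 1..N. f i $ count \<mu> i))"
    unfolding Suc.IH sum_distrib_left using C finite_bounded_partitions by (subst sum.Sigma) auto
  also have "\<dots> = (\<Sum>\<mu>\<in>bounded_partitions (Suc N) m. \<Prod>i = 1..Suc N. f i $ count \<mu> i)"
    unfolding sum.reindex_bij_betw[OF bounded_partitions_Suc, symmetric]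
  proof (rule sum.cong[OF refl])
    fix x assume "x \<in> (SIGMA c:?C. bounded_partitions N (m - Suc N * c))"
    then obtain c \<mu> where x: "x = (c, \<mu>)" "set_mset \<mu> \<subseteq> {1..N}" by (auto simp: bounded_partitions_def)
    then have "count \<mu> (Suc N) = 0" by (metis atLeastAtMost_iff not_in_iff not_less_eq_eq order_refl subsetD)
    then show "(case x of (c, \<mu>) \<Rightarrow> f (Suc N) $ c * (\<Prod>i = 1..N. f i $ count \<mu> i)) =
        (\<Prod>i = 1..Suc N. f i $ count (case x of (c, \<mu>) \<Rightarrow> \<mu> + replicate_mset c (Suc N)) i)"
      by (simp add: x(1) mult.commute)
  qed
  finally show ?case .
qed

lemma partitions_eq_bounded_partitions: "partitions n = bounded_partitions n n"
proof
  show "partitions n \<subseteq> bounded_partitions n n"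
    using partitions_parts by (auto simp: partitions_def bounded_partitions_def)
  show "bounded_partitions n n \<subseteq> partitions n"
    by (auto simp: partitions_def bounded_partitions_def)
qed


section \<open>Logarithmic derivatives of power series\<close>

text \<open>For \<open>F = (1 + x^i)^c\<close> one has
  \<open>x F' / F = i c x^i / (1 + x^i)\<close>; the last factor is the expansion of this
  quotient.\<close>

lemma X_mult_deriv_fps_binomial_compose:
  fixes c :: "'a :: field_char_0"
  assumes "i > 0"
  shows "fps_X * fps_deriv (fps_binomial c oo fps_X ^ i) =
    (fps_binomial c oo fps_X ^ i) * Abs_fps (\<lambda>k. if k > 0 \<and> i dvd k then of_nat i * c * (- 1) ^ (k div i - 1) else 0)"
proof -
  \<comment> \<open>The expansion of \<open>x / (1 + x)\<close>.\<close>
  define A :: "'a fps" where "A = Abs_fps (\<lambda>k. if k = 0 then 0 else (- 1) ^ (k - 1))"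
  have A: "(1 + fps_X) * A = fps_X"
  proof (rule fps_ext)
    fix k show "((1 + fps_X) * A) $ k = fps_X $ k"
      by (cases k; cases "k - 1") (auto simp: A_def distrib_right)
  qed
  have unit: "(1 + fps_X :: 'a fps) $ 0 \<noteq> 0" by simp
  have "(1 + fps_X) * fps_deriv (fps_binomial c) = fps_const c * fps_binomial c"
    using unit by (simp add: fps_binomial_deriv fps_divide_unit inverse_mult_eq_1' mult.left_commute)
  then have B: "fps_X * fps_deriv (fps_binomial c) = fps_const c * fps_binomial c * A"
    by (metis A mult.assoc mult.commute)
  have X0: "(fps_X ^ i :: 'a fps) $ 0 = 0" using assms by simp
  have "fps_X * fps_deriv (fps_X ^ i :: 'a fps) = fps_const (of_nat i) * fps_X ^ i"
  proof (rule fps_ext)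
    fix k show "(fps_X * fps_deriv (fps_X ^ i :: 'a fps)) $ k = (fps_const (of_nat i) * fps_X ^ i) $ k"
      using assms by (cases k) auto
  qed
  then have "fps_X * fps_deriv (fps_binomial c oo fps_X ^ i) =
      fps_const (of_nat i) * ((fps_deriv (fps_binomial c) oo fps_X ^ i) * fps_X ^ i)"
    by (simp add: fps_compose_deriv[OF X0] mult.left_commute)
  also have "(fps_deriv (fps_binomial c) oo fps_X ^ i) * fps_X ^ i =
      (fps_X * fps_deriv (fps_binomial c)) oo fps_X ^ i"
    using X0 by (simp add: fps_compose_mult_distrib mult.commute)
  also have "\<dots> = fps_const c * (fps_binomial c oo fps_X ^ i) * (A oo fps_X ^ i)"
    unfolding B using X0 by (simp add: fps_compose_mult_distrib)
  also have "fps_const (of_nat i) * \<dots> =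
      (fps_binomial c oo fps_X ^ i) * (fps_const (of_nat i * c) * (A oo fps_X ^ i))"
    by (simp add: algebra_simps flip: fps_const_mult)
  also have "fps_const (of_nat i * c) * (A oo fps_X ^ i) =
      Abs_fps (\<lambda>k. if k > 0 \<and> i dvd k then of_nat i * c * (- 1) ^ (k div i - 1) else 0)"
    using assms by (intro fps_ext) (auto simp: fps_nth_compose_X_power A_def elim!: dvdE)
  finally show ?thesis .
qed

text \<open>Logarithmic derivatives add up over a product. The form without division avoids any
  invertibility condition on the factors.\<close>

lemma X_mult_deriv_prod:
  fixes f :: "'i \<Rightarrow> 'a :: comm_ring_1 fps"
  assumes "finite I" "\<And>i. i \<in> I \<Longrightarrow> fps_X * fps_deriv (f i) = f i * g i"
  shows "fps_X * fps_deriv (prod f I) = prod f I * sum g I"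
  using assms
proof (induction I rule: finite_induct)
  case (insert i I)
  have "fps_X * fps_deriv (prod f (insert i I)) =
      prod f I * (fps_X * fps_deriv (f i)) + f i * (fps_X * fps_deriv (prod f I))"
    using insert.hyps by (simp add: algebra_simps)
  also have "\<dots> = prod f I * (f i * g i) + f i * (prod f I * sum g I)"
    using insert by simp
  also have "\<dots> = prod f (insert i I) * sum g (insert i I)"
    using insert.hyps by (simp add: algebra_simps)
  finally show ?case .
qed simp

text \<open>The coefficient of \<open>x^k\<close> in \<open>x F' = F G\<close> expresses
  \<open>k F_k\<close> through the \<open>F_j\<close> with \<open>j < k\<close>. Agreement of
  \<open>G\<close> and \<open>K\<close> only up to degree \<open>n\<close> suits a truncated
  infinite product.\<close>

lemma fps_log_deriv_unique:
  fixes F :: "'a :: field_char_0 fps"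
  assumes "fps_X * fps_deriv F = F * G" "fps_X * fps_deriv H = H * K" "F $ 0 = H $ 0"
    and "\<And>k. k \<le> n \<Longrightarrow> G $ k = K $ k" and "G $ 0 = 0"
  shows "k \<le> n \<Longrightarrow> F $ k = H $ k"
proof (induction k rule: less_induct)
  case (less k)
  show ?case
  proof (cases "k = 0")
    case False
    have rec: "of_nat k * P $ k = (\<Sum>j = 0..<k. P $ j * Q $ (k - j))"
      if "fps_X * fps_deriv P = P * Q" "Q $ 0 = 0" for P Q :: "'a fps"
    proof -
      have "of_nat k * P $ k = (fps_X * fps_deriv P) $ k" using False by simp
      also have "\<dots> = (\<Sum>j = 0..k. P $ j * Q $ (k - j))" using that by (simp add: fps_mult_nth)
      also have "\<dots> = (\<Sum>j = 0..<k. P $ j * Q $ (k - j))"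
        using that by (simp flip: atLeastLessThanSuc_atLeastAtMost)
      finally show ?thesis .
    qed
    have "(\<Sum>j = 0..<k. F $ j * G $ (k - j)) = (\<Sum>j = 0..<k. H $ j * K $ (k - j))"
      using less assms(4) by (intro sum.cong) auto
    then have "of_nat k * F $ k = of_nat k * H $ k"
      using rec[OF assms(1,5)] rec[OF assms(2)] assms(4)[of 0] assms(5) by simp
    with False show ?thesis by simp
  qed (use assms in simp)
qed

text \<open>\<open>H\<close> expands \<open>(1 - z x^2) / (1 - z x)\<close>. If \<open>z\<close> is
  a prime power, its coefficients count the squarefree monic polynomials over the field with
  \<open>z\<close> elements.\<close>

lemma squarefree_series_log_deriv:
  fixes z :: "'a :: field_char_0"
  defines "H \<equiv> Abs_fps (\<lambda>k. if k < 2 then z ^ k else z ^ k - z ^ (k - 1))"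
  shows "fps_X * fps_deriv H =
    H * Abs_fps (\<lambda>k. if k = 0 then 0 else z ^ k - (if even k then 2 * z ^ (k div 2) else 0))"
    (is "_ = H * ?K")
proof -
  \<comment> \<open>These are the inverses of \<open>1 - z x\<close> and
    \<open>1 - z x^2\<close>.\<close>
  define L L2 where "L = Abs_fps (\<lambda>k. z ^ k)" and "L2 = Abs_fps (\<lambda>k. if even k then z ^ (k div 2) else 0)"
  define Z where "Z = fps_const z"
  have L: "(1 - Z * fps_X) * L = 1"
  proof (rule fps_ext)
    fix k show "((1 - Z * fps_X) * L) $ k = 1 $ k"
      by (cases k) (auto simp: Z_def L_def left_diff_distrib mult.assoc)
  qed
  have nth_X2: "(fps_X\<^sup>2 * P) $ k = (if k < 2 then 0 else P $ (k - 2))" for P :: "'a fps" and k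
    by (simp add: fps_X_power_mult_nth)
  have L2: "(1 - Z * fps_X\<^sup>2) * L2 = 1"
  proof (rule fps_ext)
    fix k show "((1 - Z * fps_X\<^sup>2) * L2) $ k = 1 $ k"
    proof (cases "k < 2")
      case True
      then show ?thesis by (cases k) (auto simp: Z_def L2_def left_diff_distrib mult.assoc nth_X2)
    next
      case False
      then obtain j where "k = Suc (Suc j)" by (metis Suc_diff_Suc less_2_cases_iff not_less_eq not0_implies_Suc One_nat_def)
      then show ?thesis by (auto simp: Z_def L2_def left_diff_distrib mult.assoc nth_X2)
    qed
  qed
  have H: "H = (1 - Z * fps_X\<^sup>2) * L"
  proof (rule fps_ext)
    fix k show "H $ k = ((1 - Z * fps_X\<^sup>2) * L) $ k"
    proof (cases "k < 2")
      case True
      then show ?thesis by (simp add: H_def Z_def L_def left_diff_distrib mult.assoc nth_X2)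
    next
      case False
      then obtain j where "k = Suc (Suc j)" by (metis Suc_diff_Suc less_2_cases_iff not_less_eq not0_implies_Suc One_nat_def)
      then show ?thesis by (simp add: H_def Z_def L_def left_diff_distrib mult.assoc nth_X2)
    qed
  qed
  have K: "?K = Z * fps_X * L - 2 * Z * fps_X\<^sup>2 * L2"
  proof (rule fps_ext)
    fix k show "?K $ k = (Z * fps_X * L - 2 * Z * fps_X\<^sup>2 * L2) $ k"
    proof (cases "k < 2")
      case True
      then have "k = 0 \<or> k = 1" by auto
      then show ?thesis by (auto simp: Z_def L_def L2_def mult.assoc nth_X2 simp flip: fps_numeral_fps_const)
    next
      case False
      then obtain j where "k = Suc (Suc j)" by (metis Suc_diff_Suc less_2_cases_iff not_less_eq not0_implies_Suc One_nat_def)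
      then show ?thesis by (auto simp: Z_def L_def L2_def mult.assoc nth_X2 numeral_fps_const)
    qed
  qed
  \<comment> \<open>Differentiating \<open>(1 - z x) L = 1\<close> and multiplying by
    \<open>L\<close> gives \<open>L' = z L^2\<close>.\<close>
  have "fps_deriv ((1 - Z * fps_X) * L) = 0" by (simp add: L)
  then have "(1 - Z * fps_X) * fps_deriv L = Z * L" by (simp add: Z_def algebra_simps)
  then have dL: "fps_deriv L = Z * L * L"
    by (metis L mult.assoc mult.commute mult_1)
  have "fps_X * fps_deriv H = (1 - Z * fps_X\<^sup>2) * L * (Z * fps_X * L) - 2 * Z * fps_X\<^sup>2 * L"
    unfolding H by (simp add: dL Z_def fps_deriv_power algebra_simps power2_eq_square)
  also have "2 * Z * fps_X\<^sup>2 * L = (1 - Z * fps_X\<^sup>2) * L * (2 * Z * fps_X\<^sup>2 * L2)"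
    using L2 by (metis (no_types, lifting) mult.assoc mult.commute mult.left_commute mult_1_right)
  finally show ?thesis unfolding K H by (simp add: right_diff_distrib)
qed

text \<open>The sum is the coefficient of \<open>x^n\<close> in the product of the
  \<open>(1 + x^i)^(M_i)\<close>; factors with \<open>i > n\<close> do not reach this degree. The
  logarithmic derivative of the truncated product agrees with that of \<open>H\<close> up to degree
  \<open>n\<close>, and from degree 2 on \<open>H\<close> has the coefficients on the right.\<close>

theorem sum_partitions_prod_gchoose:
  fixes z :: "'a :: field_char_0"
  assumes "n \<ge> 2"
  shows "(\<Sum>\<mu>\<in>partitions n. \<Prod>i = 1..n. necklace_poly i z gchoose count \<mu> i) = z ^ n - z ^ (n - 1)"
proof -
  define F where "F = (\<Prod>i = 1..n. fps_binomial (necklace_poly i z) oo fps_X ^ i)"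
  define G where "G i = Abs_fps (\<lambda>k. if k > 0 \<and> i dvd k
      then of_nat i * necklace_poly i z * (- 1) ^ (k div i - 1) else 0)" for i
  define H where "H = Abs_fps (\<lambda>k. if k < 2 then z ^ k else z ^ k - z ^ (k - 1))"
  define K where "K = Abs_fps (\<lambda>k. if k = 0 then 0 else z ^ k - (if even k then 2 * z ^ (k div 2) else 0))"
  have "F $ n = H $ n"
  proof (rule fps_log_deriv_unique[where n = n])
    show "fps_X * fps_deriv F = F * (\<Sum>i = 1..n. G i)"
      unfolding F_def G_def by (intro X_mult_deriv_prod X_mult_deriv_fps_binomial_compose) auto
    show "fps_X * fps_deriv H = H * K"
      unfolding H_def K_def by (rule squarefree_series_log_deriv)
    show "F $ 0 = H $ 0"
    proof -
      have "\<mu> = {#}" if "\<mu> \<in> bounded_partitions n 0" for \<mu>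
        using that by (cases \<mu>) (auto simp: bounded_partitions_def)
      then have "bounded_partitions n 0 = {{#}}" by (auto simp: bounded_partitions_def)
      then show ?thesis unfolding F_def fps_nth_prod_compose_X_power by (simp add: H_def)
    qed
    show "(\<Sum>i = 1..n. G i) $ 0 = 0" by (simp add: G_def fps_sum_nth)
    show "(\<Sum>i = 1..n. G i) $ k = K $ k" if "k \<le> n" for k
    proof (cases "k = 0")
      case False
      have "(\<Sum>i = 1..n. G i) $ k = (\<Sum>i = 1..n. if i dvd k then (- 1) ^ (k div i - 1) * primitive_words i z else 0)"
        unfolding fps_sum_nth
        by (intro sum.cong) (use False in \<open>auto simp: G_def primitive_words_eq_mult_necklace_poly\<close>)
      also have "\<dots> = (\<Sum>i | i dvd k. (- 1) ^ (k div i - 1) * primitive_words i z)"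
      proof (rule sum.mono_neutral_cong_right)
        show "{i. i dvd k} \<subseteq> {1..n}"
        proof
          fix i assume "i \<in> {i. i dvd k}"
          then have "i dvd k" by simp
          then have "i > 0" "i \<le> k" using False by (auto simp: dvd_pos_nat dvd_imp_le)
          then show "i \<in> {1..n}" using that by simp
        qed
      qed auto
      also have "\<dots> = K $ k"
        using False sum_signed_primitive_words_divisors[of k z] by (simp add: K_def)
      finally show ?thesis .
    qed (simp add: G_def K_def fps_sum_nth)
  qed simp
  then show ?thesis
    using assms unfolding F_def fps_nth_prod_compose_X_power partitions_eq_bounded_partitions
    by (simp add: H_def)
qed

section \<open>Signs of generalized binomials and integrality of necklace polynomials\<close>

lemma gchoose_pos:
  fixes a :: real
  assumes "real c - 1 < a"
  shows "0 < a gchoose c"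
  unfolding gbinomial_prod_rev using assms by (intro divide_pos_pos prod_pos) auto

text \<open>Negating the upper index absorbs the sign and leaves an upper index larger than
  \<open>c - 1\<close>.\<close>

lemma gchoose_neg_sign:
  fixes a :: real
  assumes "a < 0"
  shows "0 < (- 1) ^ c * (a gchoose c)"
proof -
  have "(- 1) ^ c * (a gchoose c) = (real c - a - 1) gchoose c"
    by (subst gbinomial_negated_upper) (simp flip: mult.assoc power_mult_distrib)
  also have "\<dots> > 0" using assms by (intro gchoose_pos) simp
  finally show ?thesis .
qed

lemma gchoose_nonpos_sign:
  fixes a :: real
  assumes "a \<le> 0"
  shows "0 \<le> (- 1) ^ c * (a gchoose c)"
proof (cases "a = 0")
  case True
  then show ?thesis by (cases c) auto
next
  case False
  with assms gchoose_neg_sign[of a c] show ?thesis by simp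
qed

lemma gchoose_Ints:
  fixes a :: "'a :: field_char_0"
  assumes "a \<in> \<int>"
  shows "a gchoose c \<in> \<int>"
  using assms by (elim Ints_cases) (simp flip: of_int_gbinomial)

lemma of_real_gchoose:
  "of_real (a gchoose c) = (of_real a gchoose c :: 'a :: {real_field, field_char_0})"
  by (simp add: gbinomial_prod_rev)

text \<open>In the mass identity the partition \<open>{#m#}\<close> contributes
  \<open>M_m(a)\<close> itself, while all other terms are products of binomials in
  \<open>M_i(a)\<close> with \<open>i < m\<close>, integral by induction.\<close>

lemma necklace_poly_Ints:
  fixes a :: "'a :: field_char_0"
  assumes "a \<in> \<int>" "m > 0"
  shows "necklace_poly m a \<in> \<int>"
  using assms(2)
proof (induction m rule: less_induct)
  case (less m)
  show ?case
  proof (cases "m \<ge> 2")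
    \<comment> \<open>The mass identity starts at degree 2, so \<open>M_1(a) = a\<close> is treated
      directly.\<close>
    case False
    with less.prems have "m = 1" by simp
    then show ?thesis using assms(1) sum_primitive_words_divisors[of 1 a]
      by (simp add: necklace_poly_def)
  next
    case True
    let ?w = "\<lambda>\<mu>. \<Prod>i = 1..m. necklace_poly i a gchoose count \<mu> i"
    have mem: "{#m#} \<in> partitions m" using less.prems by (simp add: partitions_def)
    have "?w {#m#} = (\<Prod>i = 1..m. if i = m then necklace_poly m a else 1)"
      by (intro prod.cong) auto
    also have "\<dots> = necklace_poly m a" using less.prems by simp
    finally have top: "?w {#m#} = necklace_poly m a" .
    have "?w \<mu> \<in> \<int>" if "\<mu> \<in> partitions m - {{#m#}}" for \<mu>
    proof (rule Ints_prod)
      fix i assume i: "i \<in> {1..m}"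
      \<comment> \<open>A part \<open>m\<close> would exhaust the whole partition. So the factor
        with index \<open>m\<close> is a binomial with lower index 0.\<close>
      have "m \<notin># \<mu>"
      proof
        assume "m \<in># \<mu>"
        then obtain \<nu> where \<nu>: "\<mu> = add_mset m \<nu>" by (metis multi_member_split)
        with that have "\<nu> \<in> partitions 0" by (auto simp: partitions_def)
        with \<nu> that show False by (simp add: partitions_0)
      qed
      then show "necklace_poly i a gchoose count \<mu> i \<in> \<int>"
        using i less.IH[of i] by (cases "i = m") (auto intro: gchoose_Ints simp: not_in_iff)
    qed
    then have "(\<Sum>\<mu>\<in>partitions m - {{#m#}}. ?w \<mu>) \<in> \<int>" by (rule Ints_sum)
    moreover have "necklace_poly m a = a ^ m - a ^ (m - 1) - (\<Sum>\<mu>\<in>partitions m - {{#m#}}. ?w \<mu>)"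
      using sum_partitions_prod_gchoose[OF True, of a] sum.remove[OF finite_partitions mem, of ?w] top
      by (simp add: algebra_simps)
    ultimately show ?thesis using assms(1) by (auto intro: Ints_diff Ints_power)
  qed
qed

section \<open>Signs of necklace polynomials at negative arguments\<close>

lemma primitive_words_eq_diff:
  assumes "n > 0"
  shows "primitive_words n z = z ^ n - (\<Sum>m \<in> {m. m dvd n} - {n}. primitive_words m z)"
  using sum_primitive_words_divisors[OF assms, of z]
    sum.remove[of "{m. m dvd n}" n "\<lambda>m. primitive_words m z"] assms
  by (simp add: algebra_simps)

lemma primitive_words_1: "primitive_words (Suc 0) z = z"
  by (simp add: primitive_words_def)

lemma primitive_words_prime:
  assumes "prime p"
  shows "primitive_words p z = z ^ p - z"
proof -
  have "{m. m dvd p} - {p} = {1}" using assms by (auto simp: prime_nat_iff)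
  then show ?thesis using primitive_words_eq_diff[of p z] assms
    by (simp add: prime_gt_0_nat primitive_words_1)
qed

lemma primitive_words_4: "primitive_words 4 z = z ^ 4 - z ^ 2"
proof -
  have "m = 1 \<or> m = 2 \<or> m = 4" if "m dvd 4" for m :: nat
  proof -
    have "m \<in> {..4}" using dvd_imp_le[OF that] by simp
    also have "{..4} = {0, 1, 2, 3, 4 :: nat}" by auto
    finally show ?thesis using that by auto
  qed
  then have "{m. m dvd 4} - {4} = {1, 2 :: nat}" by auto
  then show ?thesis using primitive_words_eq_diff[of 4 z]
    by (simp add: primitive_words_1 primitive_words_prime)
qed

lemma primitive_words_6: "primitive_words 6 z = z ^ 6 - z ^ 3 - z ^ 2 + z"
proof -
  have "m = 1 \<or> m = 2 \<or> m = 3 \<or> m = 6" if "m dvd 6" for m :: nat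
  proof -
    have "m \<in> {..6}" using dvd_imp_le[OF that] by simp
    also have "{..6} = {0, 1, 2, 3, 4, 5, 6 :: nat}" by auto
    finally show ?thesis using that by auto
  qed
  then have "{m. m dvd 6} - {6} = {1, 2, 3 :: nat}" by auto
  then show ?thesis using primitive_words_eq_diff[of 6 z]
    by (simp add: primitive_words_1 primitive_words_prime algebra_simps)
qed

text \<open>The divisors 1 and 2 contribute -1 and 2, which already sum to \<open>(-1)^m\<close>; by
  induction nothing is left for the rest.\<close>

lemma primitive_words_minus_1:
  assumes "m \<ge> 3"
  shows "primitive_words m (- 1) = 0"
  using assms
proof (induction m rule: less_induct)
  case (less m)
  let ?A = "{d. d dvd m} - {m}"
  have "primitive_words d (- 1) = (if d = 1 then - 1 else 0) + (if d = 2 then 2 else 0 :: 'a)"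
    if "d \<in> ?A" for d
  proof -
    have "d < m" "d > 0" using that less.prems by (auto dest: dvd_imp_le intro: gr0I simp: le_less)
    then consider "d = 1" | "d = 2" | "d \<ge> 3" by linarith
    then show ?thesis
      using less.IH[of d] \<open>d < m\<close>
      by cases (auto simp: primitive_words_1 primitive_words_prime)
  qed
  then have "(\<Sum>d\<in>?A. primitive_words d (- 1 :: 'a)) =
      (\<Sum>d\<in>?A. (if d = 1 then - 1 else 0) + (if d = 2 then 2 else 0))"
    by (intro sum.cong) auto
  also have "\<dots> = (- 1) ^ m" using less.prems by (auto simp: sum.distrib)
  finally show ?case using primitive_words_eq_diff[of m "- 1 :: 'a"] less.prems by simp
qed

lemma abs_moebius_mu_le_1: "\<bar>moebius_mu d\<bar> \<le> 1"
  by (auto simp: moebius_mu_def power_abs)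

lemma sum_powers_le:
  fixes t :: real
  assumes "t \<ge> 2"
  shows "(\<Sum>j = 1..h. t ^ j) \<le> t ^ (h + 1) - t"
proof (induction h)
  case (Suc h)
  have "2 * t ^ (h + 1) \<le> t * t ^ (h + 1)" using assms by (intro mult_right_mono) auto
  with Suc show ?case by simp
qed simp

text \<open>Beyond the leading term the exponents \<open>m div d\<close> are distinct and at most
  \<open>m div 2\<close>, with coefficients of absolute value at most 1. A geometric sum with ratio
  at least 2 bounds them.\<close>

lemma primitive_words_approx:
  fixes z :: real
  assumes "\<bar>z\<bar> \<ge> 2" "m > 0"
  shows "\<bar>primitive_words m z - z ^ m\<bar> \<le> \<bar>z\<bar> ^ (m div 2 + 1) - \<bar>z\<bar>"
proof -
  let ?D = "{d. d dvd m} - {1}"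
  have fin: "finite {d. d dvd m}" using assms by simp
  have "primitive_words m z - z ^ m = (\<Sum>d\<in>?D. of_int (moebius_mu d) * z ^ (m div d))"
    unfolding primitive_words_def using fin by (subst sum.remove[of _ 1]) auto
  also have "\<bar>\<dots>\<bar> \<le> (\<Sum>d\<in>?D. \<bar>z\<bar> ^ (m div d))"
  proof (rule order_trans[OF sum_abs], rule sum_mono)
    fix d assume "d \<in> ?D"
    have "\<bar>real_of_int (moebius_mu d)\<bar> \<le> 1" using abs_moebius_mu_le_1[of d] by linarith
    then show "\<bar>of_int (moebius_mu d) * z ^ (m div d)\<bar> \<le> \<bar>z\<bar> ^ (m div d)"
      by (simp add: abs_mult power_abs mult_left_le_one_le)
  qed
  also have "\<dots> = (\<Sum>j\<in>(\<lambda>d. m div d) ` ?D. \<bar>z\<bar> ^ j)"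
  proof (rule sum.reindex_cong[symmetric, where l = "\<lambda>d. m div d"])
    show "inj_on (\<lambda>d. m div d) ?D"
    proof (rule inj_onI)
      fix d e assume "d \<in> ?D" "e \<in> ?D" "m div d = m div e"
      then have "d * (m div d) = e * (m div d)" "m div d \<noteq> 0"
        using assms(2) by (auto simp: dvd_div_eq_0_iff)
      then show "d = e" by simp
    qed
  qed auto
  also have "\<dots> \<le> (\<Sum>j = 1..m div 2. \<bar>z\<bar> ^ j)"
  proof (rule sum_mono2)
    show "(\<lambda>d. m div d) ` ?D \<subseteq> {1..m div 2}"
    proof
      fix j assume "j \<in> (\<lambda>d. m div d) ` ?D"
      then obtain d where d: "d dvd m" "d \<noteq> 1" "j = m div d" by auto
      then have m: "m = d * j" by simp
      with assms(2) have "d > 0" "j > 0" by auto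
      with d(2) have "2 * j \<le> d * j" by (intro mult_right_mono) auto
      with m have "j \<le> m div 2" by linarith
      with \<open>j > 0\<close> show "j \<in> {1..m div 2}" by simp
    qed
  qed auto
  also have "\<dots> \<le> \<bar>z\<bar> ^ (m div 2 + 1) - \<bar>z\<bar>" using assms(1) by (rule sum_powers_le)
  finally show ?thesis .
qed

lemma primitive_words_neg_lower:
  fixes t :: real
  assumes "t \<ge> 2" "m > 0"
  shows "t ^ m - t ^ (m div 2 + 1) + t \<le> (- 1) ^ m * primitive_words m (- t)"
proof -
  have "(- 1) ^ m * primitive_words m (- t) = t ^ m + (- 1) ^ m * (primitive_words m (- t) - (- t) ^ m)"
    by (simp add: right_diff_distrib flip: power_mult_distrib)
  moreover have "\<bar>(- 1) ^ m * (primitive_words m (- t) - (- t) ^ m)\<bar> \<le> t ^ (m div 2 + 1) - t"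
    using primitive_words_approx[of "- t" m] assms by (simp add: abs_mult power_abs)
  ultimately show ?thesis by linarith
qed

lemma primitive_words_neg_pos:
  fixes t :: real
  assumes "t \<ge> 2" "m > 0"
  shows "0 < (- 1) ^ m * primitive_words m (- t)"
proof (cases "m = 1")
  case True
  then show ?thesis using assms by (simp add: primitive_words_1)
next
  case False
  then have "t ^ (m div 2 + 1) \<le> t ^ m" using assms by (intro power_increasing) auto
  with primitive_words_neg_lower[OF assms] assms(1) show ?thesis by linarith
qed

text \<open>The bound \<open>t (t + 1)\<close> equals \<open>2 M_2(-t)\<close>, so the threshold for
  \<open>i = 2\<close> also settles the larger even \<open>i\<close>. With
  \<open>m = 2 h + 4\<close> the lower bound is \<open>t^(h+3) (t^(h+1) - 1) + t\<close>, and the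
  first summand is at least \<open>t^2\<close>.\<close>

lemma primitive_words_neg_even_lower:
  fixes t :: real
  assumes "t \<ge> 2" "m \<ge> 4" "even m"
  shows "t * (t + 1) \<le> primitive_words m (- t)"
proof -
  obtain k where "m = 2 * k" using assms(3) by (rule evenE)
  then have h: "m = 2 * (k - 2 + 2)" using assms(2) by simp
  define h where "h = k - 2"
  note h = h[folded h_def]
  have "1 \<le> t ^ h" using assms(1) by simp
  have "1 * t\<^sup>2 \<le> t ^ (h + 1) * t\<^sup>2"
    using assms(1) by (intro mult_right_mono) (simp_all add: one_le_power del: power_Suc)
  also have "\<dots> * 1 \<le> t ^ (h + 1) * t\<^sup>2 * (t ^ (h + 1) - 1)"
  proof (rule mult_left_mono)
    have "t * 1 \<le> t * t ^ h" using \<open>1 \<le> t ^ h\<close> assms(1) by (intro mult_left_mono) auto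
    with assms(1) have "2 \<le> t * t ^ h" by linarith
    then show "1 \<le> t ^ (h + 1) - 1" by simp
  qed (use assms(1) in simp)
  also have "\<dots> = t ^ m - t ^ (m div 2 + 1)"
  proof -
    have "m = (h + 1) + 2 + (h + 1)" "m div 2 + 1 = (h + 1) + 2" using h by simp_all
    then show ?thesis by (simp only: power_add right_diff_distrib mult_1_right)
  qed
  finally show ?thesis using primitive_words_neg_lower[of t m] assms
    by (simp add: algebra_simps power2_eq_square)
qed

lemma signed_necklace_gchoose_pos_odd:
  fixes t :: real
  assumes "odd i" "primitive_words i (- t) < 0"
  shows "0 < (- 1) ^ (i * c) * (necklace_poly i (- t) gchoose c)"
proof -
  have "necklace_poly i (- t) < 0"
    using assms by (auto simp: necklace_poly_def divide_less_0_iff intro: gr0I)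
  then show ?thesis using gchoose_neg_sign assms(1) by (simp add: power_mult)
qed

lemma signed_necklace_gchoose_pos_even:
  fixes t :: real
  assumes "even i" "i > 0" "real i * (real c - 1) < primitive_words i (- t)"
  shows "0 < (- 1) ^ (i * c) * (necklace_poly i (- t) gchoose c)"
proof -
  have "real c - 1 < necklace_poly i (- t)"
    using assms by (simp add: necklace_poly_def field_simps)
  then show ?thesis using gchoose_pos assms(1) by (simp add: power_mult)
qed

text \<open>Indices \<open>i \<ge> 3\<close> need \<open>t > 1\<close>, since already
  \<open>3 M_3(-t) = t - t^3\<close>. For \<open>n \<ge> 4\<close> the threshold forces this; for
  \<open>n = 3\<close> it only says \<open>t (t + 1) > 1\<close>, whence the third premise.\<close>

lemma signed_necklace_gchoose_pos:
  fixes t :: real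
  assumes t: "t > 0" "t * (t + 1) > real n - 2" "n = 3 \<Longrightarrow> t > 1"
    and i: "i \<in> {1..n}" "i * c \<le> n"
  shows "0 < (- 1) ^ (i * c) * (necklace_poly i (- t) gchoose c)"
proof -
  have ic: "real i * real c \<le> real n" using i(2) by (metis of_nat_le_iff of_nat_mult)
  consider "i = 1" | "i = 2" | "i \<ge> 3" using i(1) by fastforce
  then show ?thesis
  proof cases
    case 1
    then show ?thesis using t(1) by (intro signed_necklace_gchoose_pos_odd) (auto simp: primitive_words_1)
  next
    case 2
    \<comment> \<open>Here \<open>2 (c - 1) \<le> n - 2 < t (t + 1) = 2 M_2(-t)\<close>.\<close>
    then show ?thesis using t ic
      by (intro signed_necklace_gchoose_pos_even)
         (auto simp: primitive_words_prime algebra_simps power2_eq_square)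
  next
    case 3
    have "t > 1"
    proof (cases "n = 3")
      case False
      with 3 i(1) have "t * (t + 1) > 2" using t(2) by simp
      moreover have "t * (t + 1) \<le> 1 * (1 + 1)" if "t \<le> 1" using that t(1) by (intro mult_mono) auto
      ultimately show ?thesis by fastforce
    qed (rule t(3))
    show ?thesis
    proof (cases "t \<ge> 2")
      case True
      have pos: "0 < (- 1) ^ i * primitive_words i (- t)" using True 3 by (intro primitive_words_neg_pos) auto
      show ?thesis
      proof (cases "even i")
        case False
        then show ?thesis using pos by (intro signed_necklace_gchoose_pos_odd) auto
      next
        case even: True
        then have "i \<ge> 4" using 3 by (cases "i = 3") auto
        then have "t * (t + 1) \<le> primitive_words i (- t)"
          using True even by (intro primitive_words_neg_even_lower) auto
        \<comment> \<open>Now \<open>i (c - 1) \<le> n - i < n - 2\<close>, which is below the same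
          threshold.\<close>
        then show ?thesis using even 3 t(2) ic
          by (intro signed_necklace_gchoose_pos_even) (auto simp: right_diff_distrib)
      qed
    next
      case False
      have "t * (t + 1) < 2 * (2 + 1)" using False t(1) by (intro mult_strict_mono) auto
      with t(2) have "real n < 8" by simp
      then have n: "n \<le> 7" by simp
      have pow: "t < t ^ k" if "k \<ge> 2" for k
        using power_strict_increasing[of 1 k t] that \<open>t > 1\<close> by simp
      have "i \<in> {3, 4, 5, 6, 7}" using 3 i(1) n by auto
      moreover have "c \<le> 1" if "i \<ge> 4"
      proof (rule ccontr)
        assume "\<not> c \<le> 1"
        then have "4 * 2 \<le> i * c" using that by (intro mult_mono) auto
        with i(2) n show False by simp
      qed
      moreover have "t ^ 2 < t ^ 4" "t ^ 2 < t ^ 6"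
        using \<open>t > 1\<close> by (auto intro!: power_strict_increasing)
      ultimately show ?thesis
        using pow[of 3] pow[of 5] pow[of 7]
      by (elim insertE emptyE; hypsubst;
          intro signed_necklace_gchoose_pos_odd signed_necklace_gchoose_pos_even)
         (auto simp: primitive_words_prime primitive_words_4 primitive_words_6)
    qed
  qed
qed

lemma signed_necklace_gchoose_nonneg:
  fixes k i c :: nat
  assumes "k \<ge> 1" "i > 0"
  shows "0 \<le> (- 1) ^ (i * c) * (necklace_poly i (- real k) gchoose c)"
proof -
  have sign: "0 \<le> (- 1) ^ i * primitive_words i (- real k)"
  proof (cases "k \<ge> 2")
    case True
    then show ?thesis using primitive_words_neg_pos[of "real k" i] assms by simp
  next
    \<comment> \<open>At \<open>k = 1\<close> the size estimate does not apply; instead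
      \<open>M_i(-1)\<close> vanishes from \<open>i = 3\<close> on.\<close>
    case False
    with assms(1) have k: "k = 1" by simp
    consider "i = 1" | "i = 2" | "i \<ge> 3" using assms(2) by linarith
    then show ?thesis
      by cases (simp_all add: k primitive_words_1 primitive_words_prime primitive_words_minus_1)
  qed
  show ?thesis
  proof (cases "even i")
    case False
    then have "necklace_poly i (- real k) \<le> 0"
      using sign by (simp add: necklace_poly_def divide_nonpos_nonneg)
    then show ?thesis using gchoose_nonpos_sign False by (simp add: power_mult)
  next
    case True
    then have "necklace_poly i (- real k) \<ge> 0" using sign by (simp add: necklace_poly_def)
    moreover have "necklace_poly i (- real k) \<in> \<int>" using assms(2) by (intro necklace_poly_Ints) auto
    ultimately obtain j where "necklace_poly i (- real k) = real j"
      by (metis Ints_cases of_int_of_nat_eq of_int_0_le_iff zero_le_imp_eq_int)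
    then show ?thesis using True by (simp add: power_mult flip: binomial_gbinomial)
  qed
qed

section \<open>The measure\<close>

definition nu_real :: "nat \<Rightarrow> real \<Rightarrow> nat multiset \<Rightarrow> real" where
  "nu_real n x \<mu> = 1 / (x ^ (n - 1) * (x - 1)) * (\<Prod>i = 1..n. necklace_poly i x gchoose count \<mu> i)"

lemma necklace_of_real: "necklace m (of_real x) = of_real (necklace_poly m x)"
  by (simp add: necklace_def necklace_poly_def primitive_words_def)

lemma nu_class_of_real: "nu_class n (of_real x) \<mu> = of_real (nu_real n x \<mu>)"
  by (simp add: nu_class_def nu_real_def necklace_of_real of_real_gchoose)

lemma nu_of_real:
  "nu n (of_real x) g =
     of_real (nu_real n x (cycle_type n g) / real (card (conj_class n (cycle_type n g))))"
  by (simp add: nu_def nu_class_of_real)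

text \<open>The prefactor has sign \<open>(-1)^n\<close>, which splits over the parts because their
  sizes add up to \<open>n\<close>; for \<open>t > 0\<close> the remaining denominator is
  positive.\<close>

lemma nu_real_neg:
  assumes "\<mu> \<in> partitions n" "n > 0"
  shows "nu_real n (- t) \<mu> =
    (\<Prod>i = 1..n. (- 1) ^ (i * count \<mu> i) * (necklace_poly i (- t) gchoose count \<mu> i)) / (t ^ (n - 1) * (t + 1))"
proof -
  have "(\<Prod>i = 1..n. (- 1) ^ (i * count \<mu> i)) = (- 1 :: real) ^ n"
    using partitions_sum_count[OF assms(1)] by (simp flip: power_sum)
  moreover have "(- t) ^ (n - 1) * (- t - 1) = (- 1) ^ n * (t ^ (n - 1) * (t + 1))"
    using assms(2) by (cases n) (simp_all add: power_minus[of t] algebra_simps)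
  moreover have "(1 :: real) / ((- 1) ^ n * a) = (- 1) ^ n / a" for a
    by (cases "even n") auto
  ultimately show ?thesis
    by (simp add: nu_real_def prod.distrib)
qed

lemma nu_real_pos:
  assumes "\<mu> \<in> partitions n" "n > 0" "t > 0" "t * (t + 1) > real n - 2" "n = 3 \<Longrightarrow> t > 1"
  shows "0 < nu_real n (- t) \<mu>"
  unfolding nu_real_neg[OF assms(1,2)]
proof (intro divide_pos_pos prod_pos ballI)
  fix i assume i: "i \<in> {1..n}"
  have "i * count \<mu> i \<le> (\<Sum>i = 1..n. i * count \<mu> i)" using i by (intro member_le_sum) auto
  then show "0 < (- 1) ^ (i * count \<mu> i) * (necklace_poly i (- t) gchoose count \<mu> i)"
    using assms i partitions_sum_count[OF assms(1)] by (intro signed_necklace_gchoose_pos[of t n]) auto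
qed (use assms in auto)

lemma nu_real_nonneg:
  assumes "\<mu> \<in> partitions n" "n > 0" "k \<ge> 1"
  shows "0 \<le> nu_real n (- real k) \<mu>"
  unfolding nu_real_neg[OF assms(1,2)] using assms
  by (intro divide_nonneg_nonneg prod_nonneg ballI signed_necklace_gchoose_nonneg) auto

lemma sum_partitions_nu_real:
  assumes "n \<ge> 2" "x \<noteq> 0" "x \<noteq> 1"
  shows "(\<Sum>\<mu>\<in>partitions n. nu_real n x \<mu>) = 1"
proof -
  have "x ^ n - x ^ (n - 1) = x ^ (n - 1) * (x - 1)"
    using assms(1) by (cases n) (simp_all add: algebra_simps)
  then show ?thesis
    using assms sum_partitions_prod_gchoose[OF assms(1), of x]
    by (simp add: nu_real_def flip: sum_divide_distrib)
qed

text \<open>The support is spelled out so that both full support and its failure can be read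
  off.\<close>

lemma ex_pmf_of_nu:
  assumes "n \<ge> 2" "x \<noteq> 0" "x \<noteq> 1" "\<And>\<mu>. \<mu> \<in> partitions n \<Longrightarrow> 0 \<le> nu_real n x \<mu>"
  shows "\<exists>p. is_pmf_of_nu n (of_real x) p \<and> set_pmf p = {g \<in> Sn n. nu n (of_real x) g \<noteq> 0}"
proof -
  \<comment> \<open>The value 0 outside \<open>Sn n\<close> extends the weights to a density on all
    functions, as \<open>embed_pmf\<close> expects.\<close>
  define w where "w g = (if g \<in> Sn n
    then nu_real n x (cycle_type n g) / real (card (conj_class n (cycle_type n g))) else 0)" for g
  have nonneg: "0 \<le> w g" for g
    using assms(4) cycle_type_in_partitions by (auto simp: w_def)
  have "(\<Sum>g\<in>Sn n. w g) = 1"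
    using sum_Sn_average_over_conj_class[of "nu_real n x" n] sum_partitions_nu_real[OF assms(1-3)]
    by (simp add: w_def)
  moreover have "(\<integral>\<^sup>+ g. ennreal (w g) \<partial>count_space UNIV) = (\<Sum>g\<in>Sn n. ennreal (w g))"
    by (intro nn_integral_count_space' finite_Sn) (auto simp: w_def)
  ultimately have total: "(\<integral>\<^sup>+ g. ennreal (w g) \<partial>count_space UNIV) = 1"
    using nonneg by (simp add: sum_ennreal)
  have pmf: "pmf (embed_pmf w) g = w g" for g
    using nonneg total by (rule pmf_embed_pmf)
  have nu: "nu n (of_real x) g = complex_of_real (w g)" if "g \<in> Sn n" for g
    using that by (simp add: nu_of_real w_def)
  have supp: "set_pmf (embed_pmf w) = {g \<in> Sn n. nu n (of_real x) g \<noteq> 0}"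
    using nu by (auto simp: set_pmf_eq pmf) (auto simp: w_def split: if_splits)
  show ?thesis
    using supp nu pmf by (intro exI[of _ "embed_pmf w"]) (auto simp: is_pmf_of_nu_def)
qed

section \<open>The limit for large parameter\<close>

lemma tendsto_necklace_poly_at_infinity:
  assumes "i > 0"
  shows "((\<lambda>x::real. necklace_poly i x / x ^ i) \<longlongrightarrow> 1 / real i) at_infinity"
proof -
  have "((\<lambda>x::real. (\<Sum>d | d dvd i. of_int (moebius_mu d) * inverse (x ^ (i - i div d))) / real i)
      \<longlongrightarrow> (\<Sum>d | d dvd i. if d = 1 then 1 else 0) / real i) at_infinity"
  proof (intro tendsto_divide tendsto_sum tendsto_const)
    fix d assume "d \<in> {d. d dvd i}"
    then have d: "d dvd i" by simp
    show "((\<lambda>x::real. of_int (moebius_mu d) * inverse (x ^ (i - i div d)))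
        \<longlongrightarrow> (if d = 1 then 1 else 0)) at_infinity"
    proof (cases "d = 1")
      case False
      have "d > 0" using d assms by (metis dvd_pos_nat)
      with False have "i div d < i" using assms by (intro div_less_dividend) auto
      then have "filterlim (\<lambda>x::real. x ^ (i - i div d)) at_infinity at_infinity"
        by (intro filterlim_power_at_infinity filterlim_ident) auto
      then have "((\<lambda>x::real. inverse (x ^ (i - i div d))) \<longlongrightarrow> 0) at_infinity"
        using tendsto_inverse_0 filterlim_compose by blast
      with False show ?thesis by (simp add: tendsto_mult_right_zero)
    qed simp
  qed (use assms in auto)
  moreover have "\<forall>\<^sub>F x::real in at_infinity. necklace_poly i x / x ^ i =
      (\<Sum>d | d dvd i. of_int (moebius_mu d) * inverse (x ^ (i - i div d))) / real i"
  proof -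
    have "necklace_poly i x / x ^ i =
      (\<Sum>d | d dvd i. of_int (moebius_mu d) * inverse (x ^ (i - i div d))) / real i" if "norm x \<ge> 1" for x :: real
    proof -
      have "x \<noteq> 0" using that by auto
      then have "x ^ (i div d) / x ^ i = inverse (x ^ (i - i div d))" for d
        using power_diff[of x "i div d" i] by (simp add: inverse_eq_divide)
      moreover have "necklace_poly i x / x ^ i =
          (\<Sum>d | d dvd i. of_int (moebius_mu d) * (x ^ (i div d) / x ^ i)) / real i"
        by (simp add: necklace_poly_def primitive_words_def sum_divide_distrib mult.commute)
      ultimately show ?thesis by (simp only:)
    qed
    then show ?thesis unfolding eventually_at_infinity by blast
  qed
  ultimately show ?thesis using assms by (simp add: tendsto_cong)
qed

text \<open>Dividing each of the \<open>c\<close> factors of the binomial by \<open>(-t)^i\<close>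
  absorbs the sign; the shifts \<open>j\<close> become negligible and every factor tends to
  \<open>1 / i\<close>.\<close>

lemma tendsto_signed_necklace_gchoose:
  assumes "i > 0"
  shows "((\<lambda>t::real. (- 1) ^ (i * c) * (necklace_poly i (- t) gchoose c) / t ^ (i * c))
    \<longlongrightarrow> 1 / (real i ^ c * fact c)) at_top"
proof -
  have neg: "filterlim (\<lambda>t::real. - t) at_infinity at_top"
    using filterlim_mono[OF filterlim_uminus_at_bot_at_top at_bot_le_at_infinity order_refl] .
  have "((\<lambda>t::real. necklace_poly i (- t) / (- t) ^ i) \<longlongrightarrow> 1 / real i) at_top"
    by (rule filterlim_compose[OF tendsto_necklace_poly_at_infinity[OF assms] neg])
  moreover have "((\<lambda>t::real. real j / (- t) ^ i) \<longlongrightarrow> 0) at_top" for j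
    by (rule tendsto_divide_0[OF tendsto_const filterlim_compose[OF filterlim_power_at_infinity neg]]) (use assms in simp)
  ultimately have "((\<lambda>t::real. (\<Prod>j = 0..<c. necklace_poly i (- t) / (- t) ^ i - real j / (- t) ^ i) / fact c)
      \<longlongrightarrow> (\<Prod>j = 0..<c. 1 / real i - 0) / fact c) at_top"
    by (intro tendsto_divide[OF tendsto_prod tendsto_const] tendsto_diff) auto
  moreover have "(\<Prod>j = 0..<c. necklace_poly i (- t) / (- t) ^ i - real j / (- t) ^ i) / fact c =
      (- 1) ^ (i * c) * (necklace_poly i (- t) gchoose c) / t ^ (i * c)" for t :: real
  proof -
    have "(\<Prod>j = 0..<c. necklace_poly i (- t) / (- t) ^ i - real j / (- t) ^ i) =
        (\<Prod>j = 0..<c. necklace_poly i (- t) - real j) / (- t) ^ (i * c)"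
      by (simp add: prod_dividef power_mult flip: diff_divide_distrib)
    also have "\<dots> = (- 1) ^ (i * c) * (\<Prod>j = 0..<c. necklace_poly i (- t) - real j) / t ^ (i * c)"
      by (subst power_minus) (cases "even (i * c)", auto)
    finally show ?thesis by (simp add: gbinomial_prod_rev)
  qed
  ultimately show ?thesis by (simp add: power_one_over field_simps)
qed

lemma tendsto_nu_real:
  assumes "\<mu> \<in> partitions n" "n > 0"
  shows "((\<lambda>t. nu_real n (- t) \<mu>) \<longlongrightarrow> 1 / real (centralizer_size \<mu>)) at_top"
proof -
  let ?f = "\<lambda>i t. (- 1) ^ (i * count \<mu> i) * (necklace_poly i (- t) gchoose count \<mu> i) :: real"
  \<comment> \<open>The powers under the product multiply to \<open>t^n\<close>, whereas the
    denominator is \<open>t^(n-1) (t + 1)\<close>; this factor is the discrepancy.\<close>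
  have "((\<lambda>t::real. t / (t + 1)) \<longlongrightarrow> 1) at_top"
    by real_asymp
  moreover have "((\<lambda>t. \<Prod>i = 1..n. ?f i t / t ^ (i * count \<mu> i))
      \<longlongrightarrow> (\<Prod>i = 1..n. 1 / (real i ^ count \<mu> i * fact (count \<mu> i)))) at_top"
    by (intro tendsto_prod tendsto_signed_necklace_gchoose) auto
  ultimately have "((\<lambda>t. (\<Prod>i = 1..n. ?f i t / t ^ (i * count \<mu> i)) * (t / (t + 1)))
      \<longlongrightarrow> (\<Prod>i = 1..n. 1 / (real i ^ count \<mu> i * fact (count \<mu> i))) * 1) at_top"
    by (rule tendsto_mult[rotated])
  also have "(\<Prod>i = 1..n. 1 / (real i ^ count \<mu> i * fact (count \<mu> i))) * 1 = 1 / real (centralizer_size \<mu>)"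
    using centralizer_size_superset[OF _ partitions_parts[OF assms(1)]]
    by (simp add: prod_dividef)
  finally show ?thesis
  proof (rule Lim_transform_eventually)
    show "\<forall>\<^sub>F t in at_top. (\<Prod>i = 1..n. ?f i t / t ^ (i * count \<mu> i)) * (t / (t + 1)) = nu_real n (- t) \<mu>"
      using eventually_gt_at_top[of 0]
    proof eventually_elim
      case (elim t)
      have "(\<Prod>i = 1..n. t ^ (i * count \<mu> i)) = t ^ n"
        using partitions_sum_count[OF assms(1)] by (simp flip: power_sum)
      moreover have "t ^ n = t * t ^ (n - 1)" using assms(2) by (cases n) auto
      moreover have "P / (t * a) * (t / (t + 1)) = P / (a * (t + 1))" for P a
      proof -
        have "P / (t * a) * (t / (t + 1)) = (t * P) / (t * (a * (t + 1)))"
          by (simp only: times_divide_times_eq mult_ac)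
        then show ?thesis using elim by simp
      qed
      ultimately show ?case
        unfolding nu_real_neg[OF assms] prod_dividef by (simp only:)
    qed
  qed
qed

lemma tendsto_nu:
  assumes "g \<in> Sn n" "n > 0"
  shows "((\<lambda>t::real. nu n (- of_real t) g) \<longlongrightarrow> 1 / fact n) at_top"
proof -
  let ?\<mu> = "cycle_type n g"
  have \<mu>: "?\<mu> \<in> partitions n" using assms(1) by (rule cycle_type_in_partitions)
  have "real (card (conj_class n ?\<mu>)) * real (centralizer_size ?\<mu>) = fact n"
    using card_conj_class_mult_centralizer_size[OF \<mu>] by (metis of_nat_fact of_nat_mult)
  moreover from this have "real (card (conj_class n ?\<mu>)) \<noteq> 0" by (metis fact_nonzero mult_zero_left)
  with tendsto_nu_real[OF \<mu> assms(2)] have "((\<lambda>t. nu_real n (- t) ?\<mu> / real (card (conj_class n ?\<mu>))) \<longlongrightarrow>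
      1 / real (centralizer_size ?\<mu>) / real (card (conj_class n ?\<mu>))) at_top"
    by (intro tendsto_divide tendsto_const)
  ultimately have "((\<lambda>t. nu_real n (- t) ?\<mu> / real (card (conj_class n ?\<mu>))) \<longlongrightarrow> 1 / fact n) at_top"
    by (simp add: mult.commute)
  then have "((\<lambda>t. complex_of_real (nu_real n (- t) ?\<mu> / real (card (conj_class n ?\<mu>)))) \<longlongrightarrow>
      of_real (1 / fact n)) at_top"
    by (rule tendsto_of_real)
  then show ?thesis unfolding of_real_minus[symmetric] nu_of_real by simp
qed

section \<open>Vanishing on a class, and the final statement\<close>

text \<open>The value \<open>M_2(-k) = k (k + 1) / 2\<close> is a natural number smaller than
  \<open>n div 2\<close>, so the binomial for \<open>i = 2\<close> is an ordinary one with lower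
  index exceeding the upper.\<close>

lemma nu_class_vanishes:
  assumes "k \<ge> 1" "k * (k + 1) \<le> n - 2" "count \<mu> 2 = n div 2"
  shows "nu_class n (- of_nat k) \<mu> = 0"
proof -
  \<comment> \<open>Truncated subtraction makes \<open>n - 2\<close> zero for \<open>n < 2\<close>,
    which is incompatible with \<open>k \<ge> 1\<close>.\<close>
  have n: "n \<ge> 2" using assms(1,2) by (cases "n \<ge> 2") auto
  have "even (k * (k + 1))" by simp
  then obtain j where j: "k * (k + 1) = 2 * j" by (rule evenE)
  then have "real k * (real k + 1) = 2 * real j"
    by (metis of_nat_1 of_nat_add of_nat_mult of_nat_numeral)
  moreover have "necklace_poly 2 (- real k) = real k * (real k + 1) / 2"
    by (simp add: necklace_poly_def primitive_words_prime power2_eq_square algebra_simps)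
  ultimately have "necklace_poly 2 (- real k) = real j" by simp
  moreover have "j < n div 2"
    using assms(2) n unfolding j by linarith
  ultimately have "necklace_poly 2 (- real k) gchoose count \<mu> 2 = 0"
    by (simp add: assms(3) binomial_eq_0 flip: binomial_gbinomial)
  then have "nu_real n (- real k) \<mu> = 0"
    using n by (auto simp: nu_real_def intro!: bexI[of _ 2])
  then show ?thesis using nu_class_of_real[of n "- real k" \<mu>] by simp
qed

text \<open>For \<open>n = 3\<close> the class of 3-cycles has mass \<open>(t - 1) / (3 t)\<close>,
  which is not positive for \<open>t \<le> 1\<close>, although \<open>t (t + 1) > 1\<close> admits
  some such \<open>t\<close>. This is why the first part asks for \<open>t > 1\<close>
  there.\<close>

theorem theorem4p7:
  fixes n :: nat
  assumes "n \<ge> 2"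
  shows
    "(\<forall>t::real. t > 0 \<and> t * (t + 1) > real n - 2 \<and> (n = 3 \<longrightarrow> t > 1) \<longrightarrow>
        (\<forall>g \<in> Sn n. nu n (- complex_of_real t) g \<in> \<real> \<and> Re (nu n (- complex_of_real t) g) > 0) \<and>
        (\<exists>p. is_pmf_of_nu n (- complex_of_real t) p \<and> set_pmf p = Sn n)) \<and>
     (\<forall>k::nat. k \<ge> 1 \<and> k * (k + 1) \<le> n - 2 \<longrightarrow>
        (\<forall>g \<in> Sn n. nu n (- of_nat k) g \<in> \<real> \<and> Re (nu n (- of_nat k) g) \<ge> 0) \<and>
        (\<exists>p. is_pmf_of_nu n (- of_nat k) p \<and> set_pmf p \<noteq> Sn n) \<and>
        (let \<mu> = (if even n then replicate_mset (n div 2) 2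
                  else add_mset 1 (replicate_mset ((n - 1) div 2) 2))
         in nu_class n (- of_nat k) \<mu> = 0 \<and> (\<forall>g \<in> conj_class n \<mu>. nu n (- of_nat k) g = 0))) \<and>
     (\<forall>g \<in> Sn n.
        ((\<lambda>t::real. nu n (- complex_of_real t) g) \<longlongrightarrow> 1 / fact n) at_top)"
proof (intro conjI allI impI)
  fix t :: real
  assume "t > 0 \<and> t * (t + 1) > real n - 2 \<and> (n = 3 \<longrightarrow> t > 1)"
  then have t: "t > 0" "t * (t + 1) > real n - 2" "n = 3 \<Longrightarrow> t > 1" by auto
  have pos: "0 < nu_real n (- t) \<mu>" if "\<mu> \<in> partitions n" for \<mu>
    using that t assms by (intro nu_real_pos) auto
  have "nu n (of_real (- t)) g \<in> \<real> \<and> Re (nu n (of_real (- t)) g) > 0" if "g \<in> Sn n" for g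
  proof -
    have \<mu>: "cycle_type n g \<in> partitions n" using that by (rule cycle_type_in_partitions)
    have "g \<in> conj_class n (cycle_type n g)" "finite (conj_class n (cycle_type n g))"
      using that finite_Sn by (auto simp: conj_class_def)
    then have "0 < card (conj_class n (cycle_type n g))" by (auto simp: card_gt_0_iff)
    then show ?thesis using pos[OF \<mu>] unfolding nu_of_real by (auto simp del: of_real_divide)
  qed
  then show *: "\<forall>g \<in> Sn n. nu n (- complex_of_real t) g \<in> \<real> \<and> Re (nu n (- complex_of_real t) g) > 0"
    by simp
  show "\<exists>p. is_pmf_of_nu n (- complex_of_real t) p \<and> set_pmf p = Sn n"
    using ex_pmf_of_nu[of n "- t"] assms t pos * by (fastforce simp: less_imp_le)
next
  fix k :: nat
  assume "k \<ge> 1 \<and> k * (k + 1) \<le> n - 2"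
  then have k: "k \<ge> 1" "k * (k + 1) \<le> n - 2" by auto
  have of_k: "- of_nat k = complex_of_real (- real k)" by simp
  have nonneg: "0 \<le> nu_real n (- real k) \<mu>" if "\<mu> \<in> partitions n" for \<mu>
    using that k assms by (intro nu_real_nonneg) auto
  show "\<forall>g \<in> Sn n. nu n (- of_nat k) g \<in> \<real> \<and> Re (nu n (- of_nat k) g) \<ge> 0"
    unfolding of_k nu_of_real using nonneg cycle_type_in_partitions by (auto simp del: of_real_divide)
  define \<mu> where "\<mu> = (if even n then replicate_mset (n div 2) 2
    else add_mset 1 (replicate_mset ((n - 1) div 2) (2 :: nat)))"
  have part: "\<mu> \<in> partitions n"
    by (auto simp: \<mu>_def partitions_def sum_mset_replicate_mset split: if_splits elim!: oddE)
  have zero: "nu_class n (- of_nat k) \<mu> = 0"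
    using k by (rule nu_class_vanishes) (auto simp: \<mu>_def elim!: oddE)
  then have zero': "nu n (- of_nat k) g = 0" if "g \<in> conj_class n \<mu>" for g
    using that by (auto simp: nu_def conj_class_def)
  \<comment> \<open>Some permutation has this type, so the zero mass of the class removes an actual
    point from the support.\<close>
  obtain g where g: "g \<in> conj_class n \<mu>" using conj_class_nonempty[OF part] by blast
  obtain p where p: "is_pmf_of_nu n (- of_nat k) p" "set_pmf p = {g \<in> Sn n. nu n (- of_nat k) g \<noteq> 0}"
    using ex_pmf_of_nu[of n "- real k", OF assms _ _ nonneg] k(1) unfolding of_k[symmetric] by auto
  have "g \<in> Sn n" "g \<notin> set_pmf p" using g zero' p(2) by (auto simp: conj_class_def)
  with p(1) show "\<exists>p. is_pmf_of_nu n (- of_nat k) p \<and> set_pmf p \<noteq> Sn n" by blast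
  show "let \<mu> = (if even n then replicate_mset (n div 2) 2
      else add_mset 1 (replicate_mset ((n - 1) div 2) 2))
    in nu_class n (- of_nat k) \<mu> = 0 \<and> (\<forall>g \<in> conj_class n \<mu>. nu n (- of_nat k) g = 0)"
    unfolding Let_def \<mu>_def[symmetric] using zero zero' by blast
next
  show "\<forall>g \<in> Sn n. ((\<lambda>t::real. nu n (- complex_of_real t) g) \<longlongrightarrow> 1 / fact n) at_top"
    using assms tendsto_nu by auto
qed

end
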